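(* Let $n\ge2$. If $X$ is a Kan complex, then the $n$-fold simplicial set $\mathrm{Or}_{(n)}X$ is $(n,2)$-fibrant.
   Context: For a simplicial set $X$, $\mathrm{Or}_{(n)}X$ is the $n$-fold simplicial set induced by ordinal sum $\Delta^n\to\Delta$, so $(\mathrm{Or}_{(n)}X)_{p_1\cdots p_n}=X_{n-1+p_1+\cdots+p_n}$. For an $n$-fold simplicial set $Z$, indices $1\le i\ne j\le n$ and an object $a\in\Delta^{n-2}$, $Z^{(i,j)}(a)$ is the bisimplicial set obtained by fixing the value $a$ in all directions other than $i$ and $j$; direction $i$ is regarded as horizontal and $j$ as vertical, so $Z^{(i,j)}(a)_{k\bullet}$ is the vertical simplicial set in horizontal degree $k$. $Z$ is called $(n,2)$-fibrant if for each $1\le i\neq j\le n$ and each $a\in\Delta^{n-2}$, the bisimplicial set $Y$ with $Y_{k\bullet}:=\mathrm{csk}_2\,Z^{(i,j)}(a)_{k\bullet}$ ($\mathrm{csk}_2$ the 2-coskeleton functor) is such that $Y_{k\bullet}$ is a Kan complex for $k=0,1,2$ and the horizontal face map $d_0:Y_{1\bullet}\to Y_{0\bullet}$ is a (Kan) fibration of simplicial sets. *)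

theory Defs
  imports Main "HOL-Library.FuncSet"
begin

section \<open>The simplex category\<close>

text \<open>
  The object \<open>[m]\<close> is represented by the number \<open>m\<close>, with underlying ordered set \<open>{..m}\<close>.
  Monotone maps are extensional functions, so that \<open>Delta m n\<close> is exactly the hom-set from
  \<open>[m]\<close> to \<open>[n]\<close>. Composites are formed with \<^const>\<open>compose\<close>.
\<close>

definition Delta :: "nat \<Rightarrow> nat \<Rightarrow> (nat \<Rightarrow> nat) set" where
  "Delta m n = {f \<in> {..m} \<rightarrow>\<^sub>E {..n}. mono_on {..m} f}"

definition Delta_id :: "nat \<Rightarrow> nat \<Rightarrow> nat" where
  "Delta_id m = (\<lambda>t\<in>{..m}. t)"

text \<open>The injection from \<open>[m - 1]\<close> to \<open>[m]\<close> that omits \<open>i\<close>; meant for \<open>1 \<le> m\<close> and \<open>i \<le> m\<close>.\<close>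

definition coface :: "nat \<Rightarrow> nat \<Rightarrow> nat \<Rightarrow> nat" where
  "coface m i = (\<lambda>t\<in>{..m - 1}. if t < i then t else t + 1)"


section \<open>Simplicial sets\<close>

text \<open>
  For \<open>f \<in> Delta m n\<close>, the function \<open>sact X m n f\<close> is the induced map from \<open>X\<^sub>n\<close> to \<open>X\<^sub>m\<close>;
  its values outside \<open>X\<^sub>n\<close> are irrelevant.
\<close>

record 'a sset =
  scells :: "nat \<Rightarrow> 'a set"
  sact :: "nat \<Rightarrow> nat \<Rightarrow> (nat \<Rightarrow> nat) \<Rightarrow> 'a \<Rightarrow> 'a"

definition simplicial_set :: "'a sset \<Rightarrow> bool" where
  "simplicial_set X \<longleftrightarrow>
     (\<forall>m n. \<forall>f\<in>Delta m n. sact X m n f \<in> scells X n \<rightarrow> scells X m) \<and>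
     (\<forall>m. \<forall>x\<in>scells X m. sact X m m (Delta_id m) x = x) \<and>
     (\<forall>k m n. \<forall>f\<in>Delta k m. \<forall>g\<in>Delta m n. \<forall>x\<in>scells X n.
        sact X k n (compose {..k} g f) x = sact X k m f (sact X m n g x))"

definition simplicial_map :: "'a sset \<Rightarrow> 'b sset \<Rightarrow> (nat \<Rightarrow> 'a \<Rightarrow> 'b) \<Rightarrow> bool" where
  "simplicial_map X Y p \<longleftrightarrow>
     simplicial_set X \<and> simplicial_set Y \<and>
     (\<forall>m. p m \<in> scells X m \<rightarrow> scells Y m) \<and>
     (\<forall>m n. \<forall>f\<in>Delta m n. \<forall>x\<in>scells X n. p m (sact X m n f x) = sact Y m n f (p n x))"

definition face :: "'a sset \<Rightarrow> nat \<Rightarrow> nat \<Rightarrow> 'a \<Rightarrow> 'a" where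
  "face X m i = sact X (m - 1) m (coface m i)"

text \<open>
  A map from the horn \<open>\<Lambda>\<^sup>r[m]\<close> to \<open>X\<close>, given by the images \<open>x i\<close> of its faces (\<open>i \<noteq> r\<close>). The
  matching condition is vacuous for \<open>m = 1\<close>, so no face of a vertex is ever used.
\<close>

definition horn :: "'a sset \<Rightarrow> nat \<Rightarrow> nat \<Rightarrow> (nat \<Rightarrow> 'a) \<Rightarrow> bool" where
  "horn X m r x \<longleftrightarrow>
     1 \<le> m \<and> r \<le> m \<and>
     (\<forall>i\<in>{..m} - {r}. x i \<in> scells X (m - 1)) \<and>
     (\<forall>i\<in>{..m} - {r}. \<forall>j\<in>{..m} - {r}. i < j \<longrightarrow>
        face X (m - 1) i (x j) = face X (m - 1) (j - 1) (x i))"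

definition kan_complex :: "'a sset \<Rightarrow> bool" where
  "kan_complex X \<longleftrightarrow>
     simplicial_set X \<and>
     (\<forall>m r x. horn X m r x \<longrightarrow>
        (\<exists>z\<in>scells X m. \<forall>i\<in>{..m} - {r}. face X m i z = x i))"

definition kan_fibration :: "'a sset \<Rightarrow> 'b sset \<Rightarrow> (nat \<Rightarrow> 'a \<Rightarrow> 'b) \<Rightarrow> bool" where
  "kan_fibration E B p \<longleftrightarrow>
     simplicial_map E B p \<and>
     (\<forall>m r x. \<forall>y\<in>scells B m.
        horn E m r x \<and> (\<forall>i\<in>{..m} - {r}. face B m i y = p (m - 1) (x i)) \<longrightarrow>
        (\<exists>z\<in>scells E m. (\<forall>i\<in>{..m} - {r}. face E m i z = x i) \<and> p m z = y))"


section \<open>Coskeleta\<close>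

text \<open>
  The \<open>N\<close>-coskeleton is the composite of \<open>N\<close>-truncation with its right adjoint: an \<open>m\<close>-simplex
  of it is a map from the \<open>N\<close>-truncation of \<open>\<Delta>[m]\<close> to the \<open>N\<close>-truncation of \<open>X\<close>, that is, a
  family of functions from \<open>Delta k m\<close> to \<open>X\<^sub>k\<close>, for \<open>k \<le> N\<close>, which is natural in \<open>k\<close>.
\<close>

definition csk :: "nat \<Rightarrow> 'a sset \<Rightarrow> (nat \<Rightarrow> (nat \<Rightarrow> nat) \<Rightarrow> 'a) sset" where
  "csk N X =
     \<lparr> scells = (\<lambda>m. {\<phi> \<in> (\<Pi>\<^sub>E k\<in>{..N}. Delta k m \<rightarrow>\<^sub>E scells X k).
         \<forall>k\<le>N. \<forall>l\<le>N. \<forall>f\<in>Delta k l. \<forall>h\<in>Delta l m.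
           \<phi> k (compose {..k} h f) = sact X k l f (\<phi> l h)}),
       sact = (\<lambda>m n g \<phi>. \<lambda>k\<in>{..N}. \<lambda>h\<in>Delta k m. \<phi> k (compose {..k} g h)) \<rparr>"

text \<open>The action of the coskeleton functor on a simplicial map \<open>p\<close>.\<close>

definition csk_map ::
  "nat \<Rightarrow> (nat \<Rightarrow> 'a \<Rightarrow> 'b) \<Rightarrow>
   nat \<Rightarrow> (nat \<Rightarrow> (nat \<Rightarrow> nat) \<Rightarrow> 'a) \<Rightarrow> nat \<Rightarrow> (nat \<Rightarrow> nat) \<Rightarrow> 'b" where
  "csk_map N p m \<phi> = (\<lambda>k\<in>{..N}. \<lambda>h\<in>Delta k m. p k (\<phi> k h))"


section \<open>Bisimplicial sets\<close>

text \<open>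
  In \<open>bcells W k l\<close> the index \<open>k\<close> is horizontal and \<open>l\<close> is vertical. For \<open>f \<in> Delta k k'\<close> and
  \<open>g \<in> Delta l l'\<close>, the function \<open>bact W k l k' l' f g\<close> maps \<open>bcells W k' l'\<close> to \<open>bcells W k l\<close>.
\<close>

record 'a bisset =
  bcells :: "nat \<Rightarrow> nat \<Rightarrow> 'a set"
  bact :: "nat \<Rightarrow> nat \<Rightarrow> nat \<Rightarrow> nat \<Rightarrow> (nat \<Rightarrow> nat) \<Rightarrow> (nat \<Rightarrow> nat) \<Rightarrow> 'a \<Rightarrow> 'a"

definition vertical :: "'a bisset \<Rightarrow> nat \<Rightarrow> 'a sset" where
  "vertical W k =
     \<lparr> scells = bcells W k,
       sact = (\<lambda>l l' g. bact W k l k l' (Delta_id k) g) \<rparr>"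

text \<open>For \<open>f \<in> Delta k k'\<close>, the map from \<open>vertical W k'\<close> to \<open>vertical W k\<close> induced by \<open>f\<close>.\<close>

definition horizontal_map ::
  "'a bisset \<Rightarrow> nat \<Rightarrow> nat \<Rightarrow> (nat \<Rightarrow> nat) \<Rightarrow> nat \<Rightarrow> 'a \<Rightarrow> 'a" where
  "horizontal_map W k k' f l = bact W k l k' l f (Delta_id l)"

definition horizontal_face :: "'a bisset \<Rightarrow> nat \<Rightarrow> nat \<Rightarrow> nat \<Rightarrow> 'a \<Rightarrow> 'a" where
  "horizontal_face W k i = horizontal_map W (k - 1) k (coface k i)"

text \<open>The bisimplicial set obtained by applying \<open>csk N\<close> to each \<open>vertical W k\<close>.\<close>

definition vertical_csk :: "nat \<Rightarrow> 'a bisset \<Rightarrow> (nat \<Rightarrow> (nat \<Rightarrow> nat) \<Rightarrow> 'a) bisset" where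
  "vertical_csk N W =
     \<lparr> bcells = (\<lambda>k. scells (csk N (vertical W k))),
       bact = (\<lambda>k l k' l' f g \<phi>.
         csk_map N (horizontal_map W k k' f) l (sact (csk N (vertical W k')) l l' g \<phi>)) \<rparr>"


section \<open>Multisimplicial sets\<close>

text \<open>
  Objects and morphisms of the \<open>n\<close>-fold power of the simplex category are families indexed by
  \<open>{1..n}\<close>, again taken to be extensional. For \<open>F \<in> nDelta n p q\<close>, the function
  \<open>mact Z p q F\<close> maps \<open>mcells Z q\<close> to \<open>mcells Z p\<close>.
\<close>

definition nDelta_obj :: "nat \<Rightarrow> (nat \<Rightarrow> nat) set" where
  "nDelta_obj n = {1..n} \<rightarrow>\<^sub>E UNIV"

definition nDelta :: "nat \<Rightarrow> (nat \<Rightarrow> nat) \<Rightarrow> (nat \<Rightarrow> nat) \<Rightarrow> (nat \<Rightarrow> nat \<Rightarrow> nat) set" where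
  "nDelta n p q = (\<Pi>\<^sub>E s\<in>{1..n}. Delta (p s) (q s))"

definition nDelta_id :: "nat \<Rightarrow> (nat \<Rightarrow> nat) \<Rightarrow> nat \<Rightarrow> nat \<Rightarrow> nat" where
  "nDelta_id n p = (\<lambda>s\<in>{1..n}. Delta_id (p s))"

definition nDelta_comp ::
  "nat \<Rightarrow> (nat \<Rightarrow> nat) \<Rightarrow> (nat \<Rightarrow> nat \<Rightarrow> nat) \<Rightarrow> (nat \<Rightarrow> nat \<Rightarrow> nat) \<Rightarrow> nat \<Rightarrow> nat \<Rightarrow> nat" where
  "nDelta_comp n p G F = (\<lambda>s\<in>{1..n}. compose {..p s} (G s) (F s))"

record 'a msset =
  mcells :: "(nat \<Rightarrow> nat) \<Rightarrow> 'a set"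
  mact :: "(nat \<Rightarrow> nat) \<Rightarrow> (nat \<Rightarrow> nat) \<Rightarrow> (nat \<Rightarrow> nat \<Rightarrow> nat) \<Rightarrow> 'a \<Rightarrow> 'a"

definition nfold_simplicial_set :: "nat \<Rightarrow> 'a msset \<Rightarrow> bool" where
  "nfold_simplicial_set n Z \<longleftrightarrow>
     (\<forall>p\<in>nDelta_obj n. \<forall>q\<in>nDelta_obj n. \<forall>F\<in>nDelta n p q.
        mact Z p q F \<in> mcells Z q \<rightarrow> mcells Z p) \<and>
     (\<forall>p\<in>nDelta_obj n. \<forall>z\<in>mcells Z p. mact Z p p (nDelta_id n p) z = z) \<and>
     (\<forall>p\<in>nDelta_obj n. \<forall>q\<in>nDelta_obj n. \<forall>r\<in>nDelta_obj n.
        \<forall>F\<in>nDelta n p q. \<forall>G\<in>nDelta n q r. \<forall>z\<in>mcells Z r.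
          mact Z p r (nDelta_comp n p G F) z = mact Z p q F (mact Z q r G z))"

text \<open>
  The bisimplicial set \<open>Z\<^sup>(\<^sup>i\<^sup>,\<^sup>j\<^sup>)(a)\<close>, where the object \<open>a\<close> is a family indexed by
  \<open>{1..n} - {i, j}\<close>.
\<close>

definition bislice ::
  "nat \<Rightarrow> 'a msset \<Rightarrow> nat \<Rightarrow> nat \<Rightarrow> (nat \<Rightarrow> nat) \<Rightarrow> 'a bisset" where
  "bislice n Z i j a =
     \<lparr> bcells = (\<lambda>k l. mcells Z (a(i := k, j := l))),
       bact = (\<lambda>k l k' l' f g.
         mact Z (a(i := k, j := l)) (a(i := k', j := l'))
           ((\<lambda>s\<in>{1..n}. Delta_id (a s))(i := f, j := g))) \<rparr>"

definition n2_fibrant :: "nat \<Rightarrow> 'a msset \<Rightarrow> bool" where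
  "n2_fibrant n Z \<longleftrightarrow>
     nfold_simplicial_set n Z \<and>
     (\<forall>i\<in>{1..n}. \<forall>j\<in>{1..n}. i \<noteq> j \<longrightarrow>
       (\<forall>a \<in> ({1..n} - {i, j}) \<rightarrow>\<^sub>E UNIV.
         let Y = vertical_csk 2 (bislice n Z i j a) in
           (\<forall>k\<in>{0, 1, 2}. kan_complex (vertical Y k)) \<and>
           kan_fibration (vertical Y 1) (vertical Y 0) (horizontal_face Y 1 0)))"


section \<open>Ordinal sum\<close>

text \<open>
  The ordinal sum of \<open>[p 1], \<dots>, [p n]\<close> is \<open>[n - 1 + p 1 + \<dots> + p n]\<close>; the element \<open>t\<close> of its
  \<open>s\<close>-th summand is the number \<open>osum_offset p s + t\<close>.
\<close>

definition osum_obj :: "nat \<Rightarrow> (nat \<Rightarrow> nat) \<Rightarrow> nat" where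
  "osum_obj n p = n - 1 + (\<Sum>s\<in>{1..n}. p s)"

definition osum_offset :: "(nat \<Rightarrow> nat) \<Rightarrow> nat \<Rightarrow> nat" where
  "osum_offset p s = (\<Sum>r\<in>{1..<s}. p r + 1)"

definition osum_block :: "nat \<Rightarrow> (nat \<Rightarrow> nat) \<Rightarrow> nat \<Rightarrow> nat" where
  "osum_block n p t =
     (THE s. s \<in> {1..n} \<and> osum_offset p s \<le> t \<and> t \<le> osum_offset p s + p s)"

definition osum_map ::
  "nat \<Rightarrow> (nat \<Rightarrow> nat) \<Rightarrow> (nat \<Rightarrow> nat) \<Rightarrow> (nat \<Rightarrow> nat \<Rightarrow> nat) \<Rightarrow> nat \<Rightarrow> nat" where
  "osum_map n p q F =
     (\<lambda>t\<in>{..osum_obj n p}.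
        let s = osum_block n p t in osum_offset q s + F s (t - osum_offset p s))"

definition Or :: "nat \<Rightarrow> 'a sset \<Rightarrow> 'a msset" where
  "Or n X =
     \<lparr> mcells = (\<lambda>p. scells X (osum_obj n p)),
       mact = (\<lambda>p q F. sact X (osum_obj n p) (osum_obj n q) (osum_map n p q F)) \<rparr>"

end

theory Submission imports Defs begin

text \<open>
  A Kan complex has fillers for all partial boundaries of a simplex, that is, for any nonempty
  proper set of faces. A horn or a boundary in a vertical simplicial set of the slice at
  \<open>(i, j)\<close> is such a partial boundary in \<open>X\<close>, with faces in the block of \<open>j\<close>, and a lifting
  problem against a horizontal face map only adds one face in the block of \<open>i\<close>. So horns and also
  boundaries of dimension 2 lift. The latter is what the coskeleton needs: a horn in \<open>csk\<^sub>2\<close> of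
  dimension 3 is filled by filling the boundary of its missing face, and above dimension 2 the
  boundaries in \<open>csk\<^sub>2\<close> fill for free.
\<close>

section \<open>The simplex category\<close>

text \<open>The 2 comes from the matching conditions. Two distinct faces of an edge are disjoint in
  a column of the slice, but the corresponding faces of the simplex of \<open>X\<close> meet,
  because the ordinal sum has further blocks. The boundary of an edge in a column therefore need not
  be a compatible family in \<open>X\<close>, whereas from dimension 2 on the matching conditions of
  the column are those of \<open>X\<close>. What makes a full boundary solvable at all is again the
  presence of other blocks: the faces opposite to their vertices are missing, so the family of faces
  is proper and the Kan condition applies. Kan complexes are handled as fibrations over a point, so
  that the extension of partial boundaries and the passage to coskeleta are each proved once, in
  relative form.\<close>

lemma Delta_le: "f \<in> Delta m n \<Longrightarrow> t \<le> m \<Longrightarrow> f t \<le> n"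
  unfolding Delta_def by auto

lemma Delta_mono: "f \<in> Delta m n \<Longrightarrow> s \<le> t \<Longrightarrow> t \<le> m \<Longrightarrow> f s \<le> f t"
  unfolding Delta_def mono_on_def by auto

lemma Delta_undefined: "f \<in> Delta m n \<Longrightarrow> \<not> t \<le> m \<Longrightarrow> f t = undefined"
  unfolding Delta_def by auto

lemma DeltaI:
  assumes "\<And>t. t \<le> m \<Longrightarrow> f t \<le> n"
    and "\<And>s t. s \<le> t \<Longrightarrow> t \<le> m \<Longrightarrow> f s \<le> f t"
    and "\<And>t. \<not> t \<le> m \<Longrightarrow> f t = undefined"
  shows "f \<in> Delta m n"
  using assms unfolding Delta_def mono_on_def by (auto intro!: PiE_I)

lemma Delta_eqI:
  assumes "f \<in> Delta m n" "g \<in> Delta m n'" "\<And>t. t \<le> m \<Longrightarrow> f t = g t"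
  shows "f = g"
  using assms Delta_undefined by (metis ext)

lemma Delta_id_in: "Delta_id m \<in> Delta m m"
  by (rule DeltaI) (auto simp: Delta_id_def)

lemma compose_in_Delta:
  assumes "f \<in> Delta k m" "g \<in> Delta m n"
  shows "compose {..k} g f \<in> Delta k n"
proof (rule DeltaI)
  fix s t assume "s \<le> t" "t \<le> k"
  then show "compose {..k} g f s \<le> compose {..k} g f t"
    using Delta_mono[OF assms(2) Delta_mono[OF assms(1)]] Delta_le[OF assms(1)]
    by (simp add: compose_def)
qed (auto simp: compose_def intro!: Delta_le[OF assms(2)] Delta_le[OF assms(1)])

lemma compose_Delta_id_left: "f \<in> Delta k m \<Longrightarrow> compose {..k} (Delta_id m) f = f"
  by (rule Delta_eqI[OF compose_in_Delta[OF _ Delta_id_in]])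
    (auto simp: compose_def Delta_id_def Delta_le)

lemma compose_Delta_id_right: "f \<in> Delta m n \<Longrightarrow> compose {..m} f (Delta_id m) = f"
  by (rule Delta_eqI[OF compose_in_Delta[OF Delta_id_in]])
    (auto simp: compose_def Delta_id_def)

lemma compose_Delta_assoc:
  "f \<in> Delta k l \<Longrightarrow> compose {..k} h (compose {..k} g f) = compose {..k} (compose {..l} h g) f"
  by (rule compose_assoc) (auto simp: Delta_def)

lemma coface_in_Delta: "i \<le> Suc m \<Longrightarrow> coface (Suc m) i \<in> Delta m (Suc m)"
  by (rule DeltaI) (auto simp: coface_def)

lemma coface_coface:
  assumes "i < j" "j \<le> Suc (Suc m)"
  shows "compose {..m} (coface (Suc (Suc m)) j) (coface (Suc m) i) =
    compose {..m} (coface (Suc (Suc m)) i) (coface (Suc m) (j - 1))"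
  by (rule ext) (use assms in \<open>auto simp: compose_def coface_def\<close>)

text \<open>Postcomposition with the codegeneracy that identifies \<open>i\<close> and
  \<open>i + 1\<close>. For a map \<open>h\<close> that omits \<open>i\<close> it is the unique
  factor of \<open>h\<close> through the coface omitting \<open>i\<close>.\<close>

definition cofactor :: "nat \<Rightarrow> nat \<Rightarrow> (nat \<Rightarrow> nat) \<Rightarrow> nat \<Rightarrow> nat" where
  "cofactor k i h = (\<lambda>t\<in>{..k}. if i < h t then h t - 1 else h t)"

lemma cofactor_in_Delta:
  assumes "h \<in> Delta k (Suc m)" "i \<le> Suc m" "i \<notin> h ` {..k}"
  shows "cofactor k i h \<in> Delta k m"
proof (rule DeltaI)
  fix t assume t: "t \<le> k"
  have "h t \<noteq> i" using assms(3) t by auto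
  then show "cofactor k i h t \<le> m"
    using Delta_le[OF assms(1) t] assms(2) t by (auto simp: cofactor_def)
next
  fix s t assume st: "s \<le> t" "t \<le> k"
  have "h s \<le> h t" using Delta_mono[OF assms(1) st] .
  then show "cofactor k i h s \<le> cofactor k i h t" using st by (auto simp: cofactor_def)
qed (auto simp: cofactor_def)

lemma compose_coface_cofactor:
  assumes "h \<in> Delta k (Suc m)" "i \<le> Suc m" "i \<notin> h ` {..k}"
  shows "compose {..k} (coface (Suc m) i) (cofactor k i h) = h"
proof (rule Delta_eqI[OF compose_in_Delta[OF cofactor_in_Delta[OF assms] coface_in_Delta[OF assms(2)]] assms(1)])
  fix t assume t: "t \<le> k"
  have "h t \<noteq> i" using assms(3) t by auto
  then show "compose {..k} (coface (Suc m) i) (cofactor k i h) t = h t"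
    using Delta_le[OF assms(1) t] Delta_le[OF cofactor_in_Delta[OF assms] t] t
    by (auto simp: cofactor_def compose_def coface_def)
qed

lemma cofactor_compose_coface:
  assumes "h \<in> Delta k m"
  shows "cofactor k i (compose {..k} (coface (Suc m) i) h) = h"
proof (rule ext)
  fix t show "cofactor k i (compose {..k} (coface (Suc m) i) h) t = h t"
  proof (cases "t \<le> k")
    case True
    then show ?thesis using Delta_le[OF assms True]
      by (auto simp: cofactor_def compose_def coface_def)
  qed (simp add: cofactor_def Delta_undefined[OF assms])
qed

lemma coface_omits: "h \<in> Delta k m \<Longrightarrow> i \<notin> compose {..k} (coface (Suc m) i) h ` {..k}"
  by (auto simp: compose_def coface_def Delta_le)

text \<open>As \<open>cofactor\<close> is postcomposition with a fixed function, it commutes with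
  precomposition even when \<open>h\<close> does not omit \<open>i\<close>.\<close>

lemma cofactor_compose:
  assumes "f \<in> Delta k l"
  shows "cofactor k i (compose {..k} h f) = compose {..k} (cofactor l i h) f"
  by (rule ext) (use assms in \<open>auto simp: cofactor_def compose_def Delta_le\<close>)

section \<open>Simplicial sets and their faces\<close>

lemma sact_closed:
  "simplicial_set X \<Longrightarrow> f \<in> Delta m n \<Longrightarrow> x \<in> scells X n \<Longrightarrow> sact X m n f x \<in> scells X m"
  unfolding simplicial_set_def by blast

lemma sact_id: "simplicial_set X \<Longrightarrow> x \<in> scells X m \<Longrightarrow> sact X m m (Delta_id m) x = x"
  unfolding simplicial_set_def by blast

lemma sact_compose:
  "simplicial_set X \<Longrightarrow> f \<in> Delta k m \<Longrightarrow> g \<in> Delta m n \<Longrightarrow> x \<in> scells X n \<Longrightarrow>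
    sact X k n (compose {..k} g f) x = sact X k m f (sact X m n g x)"
  unfolding simplicial_set_def by blast

lemma simplicial_map_sets:
  assumes "simplicial_map E B p"
  shows "simplicial_set E" "simplicial_set B"
  using assms unfolding simplicial_map_def by auto

lemma simplicial_map_closed:
  "simplicial_map E B p \<Longrightarrow> x \<in> scells E m \<Longrightarrow> p m x \<in> scells B m"
  unfolding simplicial_map_def by blast

lemma simplicial_map_act:
  "simplicial_map E B p \<Longrightarrow> f \<in> Delta m n \<Longrightarrow> x \<in> scells E n \<Longrightarrow>
    p m (sact E m n f x) = sact B m n f (p n x)"
  unfolding simplicial_map_def by blast

lemma face_closed:
  "simplicial_set X \<Longrightarrow> i \<le> Suc m \<Longrightarrow> x \<in> scells X (Suc m) \<Longrightarrow> face X (Suc m) i x \<in> scells X m"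
  by (simp add: face_def sact_closed coface_in_Delta)

lemma face_face:
  assumes "simplicial_set X" "i < j" "j \<le> Suc (Suc m)" "x \<in> scells X (Suc (Suc m))"
  shows "face X (Suc m) i (face X (Suc (Suc m)) j x) =
    face X (Suc m) (j - 1) (face X (Suc (Suc m)) i x)"
proof -
  have "i \<le> Suc m" "j - 1 \<le> Suc m" "i \<le> Suc (Suc m)" using assms by auto
  then show ?thesis
    using coface_coface[OF assms(2,3)] assms
    by (simp add: face_def coface_in_Delta flip: sact_compose)
qed

lemma simplicial_map_face:
  "simplicial_map E B p \<Longrightarrow> i \<le> Suc m \<Longrightarrow> x \<in> scells E (Suc m) \<Longrightarrow>
    p m (face E (Suc m) i x) = face B (Suc m) i (p (Suc m) x)"
  by (simp add: face_def simplicial_map_act coface_in_Delta)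

section \<open>Lifting against partial boundaries\<close>

text \<open>
  A map to \<open>X\<close> from the union of the faces of \<open>\<Delta>[m]\<close> opposite to the vertices in \<open>I\<close>. For
  \<open>m = 1\<close> there is no condition, because distinct faces of an edge are disjoint.
\<close>

definition matching :: "'a sset \<Rightarrow> nat \<Rightarrow> nat set \<Rightarrow> (nat \<Rightarrow> 'a) \<Rightarrow> bool" where
  "matching X m I x \<longleftrightarrow>
     (\<forall>i\<in>I. x i \<in> scells X (m - 1)) \<and>
     (2 \<le> m \<longrightarrow> (\<forall>i\<in>I. \<forall>j\<in>I. i < j \<longrightarrow>
        face X (m - 1) i (x j) = face X (m - 1) (j - 1) (x i)))"

text \<open>The right lifting property against one single inclusion. Keeping \<open>m\<close> and
  \<open>I\<close> as parameters allows inductions that change both, and allows full boundaries to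
  be assumed in one dimension only.\<close>

definition lifts :: "'a sset \<Rightarrow> 'b sset \<Rightarrow> (nat \<Rightarrow> 'a \<Rightarrow> 'b) \<Rightarrow> nat \<Rightarrow> nat set \<Rightarrow> bool" where
  "lifts E B p m I \<longleftrightarrow>
     (\<forall>x. \<forall>y\<in>scells B m. matching E m I x \<longrightarrow> (\<forall>i\<in>I. face B m i y = p (m - 1) (x i)) \<longrightarrow>
       (\<exists>z\<in>scells E m. (\<forall>i\<in>I. face E m i z = x i) \<and> p m z = y))"

text \<open>The two notions differ only by the guard \<open>2 \<le> m\<close> in
  \<open>matching\<close>. An edge with one face removed has no pair of distinct faces left, so the
  guard costs nothing on horns.\<close>

lemma horn_iff_matching:
  "horn X m r x \<longleftrightarrow> 1 \<le> m \<and> r \<le> m \<and> matching X m ({..m} - {r}) x"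
proof (cases "2 \<le> m")
  case False
  then have "\<not> i < j" if "i \<in> {..m} - {r}" "j \<in> {..m} - {r}" "r \<le> m" for i j
    using that by auto
  then show ?thesis using False unfolding horn_def matching_def by blast
qed (auto simp: horn_def matching_def)

lemma kan_fibration_iff_lifts:
  "kan_fibration E B p \<longleftrightarrow>
    simplicial_map E B p \<and> (\<forall>m r. 1 \<le> m \<longrightarrow> r \<le> m \<longrightarrow> lifts E B p m ({..m} - {r}))"
  unfolding kan_fibration_def lifts_def horn_iff_matching by blast

text \<open>
  The missing face opposite to \<open>k\<close> meets the given faces in a partial boundary of dimension
  \<open>m - 1\<close>, whose lift can be adjoined to the lifting problem.
\<close>

lemma lifts_insert:
  assumes p: "simplicial_map E B p" and m: "2 \<le> m" and I: "I \<subseteq> {..m}"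
    and k: "k \<le> m" "k \<notin> I"
    and l1: "lifts E B p (m - 1) {t. t \<le> m - 1 \<and> coface m k t \<in> I}"
    and l2: "lifts E B p m (insert k I)"
  shows "lifts E B p m I"
  unfolding lifts_def
proof (intro allI ballI impI)
  fix x y
  assume y: "y \<in> scells B m" and x: "matching E m I x"
    and xy: "\<forall>i\<in>I. face B m i y = p (m - 1) (x i)"
  obtain M where M: "m = Suc (Suc M)" using m by (metis One_nat_def Suc_1 Suc_le_D Suc_le_mono)
  note E = simplicial_map_sets(1)[OF p] and B = simplicial_map_sets(2)[OF p]
  have xc: "x i \<in> scells E (Suc M)" if "i \<in> I" for i using x that by (simp add: matching_def M)
  have xm: "face E (Suc M) i (x j) = face E (Suc M) (j - 1) (x i)" if "i \<in> I" "j \<in> I" "i < j" for i j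
    using x that by (simp add: matching_def M)
  have Ile: "i \<le> Suc (Suc M)" if "i \<in> I" for i using I that by (auto simp: M)
  define I' where "I' = {t. t \<le> Suc M \<and> coface m k t \<in> I}"
  have I'1: "t \<in> I" if "t \<in> I'" "t < k" for t using that by (auto simp: I'_def coface_def M)
  have I'2: "Suc t \<in> I" if "t \<in> I'" "k \<le> t" for t using that by (auto simp: I'_def coface_def M)
  have I'le: "t \<le> Suc M" if "t \<in> I'" for t using that by (auto simp: I'_def)
  have l1': "lifts E B p (Suc M) I'" using l1 by (simp add: I'_def M)
  \<comment> \<open>With d_t d_k = d_{k-1} d_t for t < k and d_t d_k = d_k d_{t+1} for k \<le> t,
    these are the faces that the given family forces on the missing face.\<close>
  define x' where "x' t = (if t < k then face E (Suc M) (k - 1) (x t) else face E (Suc M) k (x (Suc t)))" for t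
  have kM: "k \<le> Suc (Suc M)" using k by (simp add: M)
  have "matching E (Suc M) I' x'"
    unfolding matching_def
  proof (intro conjI ballI impI)
    fix t assume t: "t \<in> I'"
    show "x' t \<in> scells E (Suc M - 1)"
      using I'1[OF t] I'2[OF t] I'le[OF t] kM by (auto simp: x'_def intro!: face_closed[OF E] xc)
  next
    fix s t assume st: "s \<in> I'" "t \<in> I'" "s < t" and M2: "2 \<le> Suc M"
    obtain L where L: "M = Suc L" using M2 by (cases M) auto
    have ff: "face E (Suc L) u (face E (Suc (Suc L)) v w) = face E (Suc L) (v - 1) (face E (Suc (Suc L)) u w)"
      if "u < v" "v \<le> Suc (Suc L)" "w \<in> scells E (Suc (Suc L))" for u v w
      using face_face[OF E that] .
    have xc': "x i \<in> scells E (Suc (Suc L))" if "i \<in> I" for i using xc[OF that] L by simp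
    have xm': "face E (Suc (Suc L)) i (x j) = face E (Suc (Suc L)) (j - 1) (x i)" if "i \<in> I" "j \<in> I" "i < j" for i j
      using xm[OF that] L by simp
    have "face E (Suc L) s (x' t) = face E (Suc L) (t - 1) (x' s)"
    proof -
      \<comment> \<open>In each position of \<open>k\<close> the equation is one use of the matching
        condition of \<open>x\<close> between two simplicial identities.\<close>
      consider "t < k" | "s < k" "k \<le> t" | "k \<le> s" using st by linarith
      then show ?thesis
      proof cases
        case 1
        have i: "s \<in> I" "t \<in> I" using I'1 st 1 by auto
        have "face E (Suc L) s (x' t) = face E (Suc L) s (face E (Suc (Suc L)) (k - 1) (x t))"
          using 1 by (simp add: x'_def L)
        also have "\<dots> = face E (Suc L) (k - 1 - 1) (face E (Suc (Suc L)) s (x t))"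
          using 1 st kM L by (intro ff xc' i) auto
        also have "\<dots> = face E (Suc L) (k - 1 - 1) (face E (Suc (Suc L)) (t - 1) (x s))"
          using xm'[OF i st(3)] by simp
        also have "\<dots> = face E (Suc L) (t - 1) (face E (Suc (Suc L)) (k - 1) (x s))"
          using 1 st kM L by (intro ff[symmetric] xc' i) auto
        finally show ?thesis using 1 st by (simp add: x'_def L)
      next
        case 2
        have i: "s \<in> I" "Suc t \<in> I" using I'1 I'2 st 2 by auto
        have "face E (Suc L) s (x' t) = face E (Suc L) s (face E (Suc (Suc L)) k (x (Suc t)))"
          using 2 by (simp add: x'_def L)
        also have "\<dots> = face E (Suc L) (k - 1) (face E (Suc (Suc L)) s (x (Suc t)))"
          using 2 st I'le[OF st(2)] L by (intro ff xc' i) auto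
        also have "\<dots> = face E (Suc L) (k - 1) (face E (Suc (Suc L)) t (x s))"
          using xm'[OF i] st(3) by simp
        also have "\<dots> = face E (Suc L) (t - 1) (face E (Suc (Suc L)) (k - 1) (x s))"
          using 2 st I'le[OF st(2)] L by (intro ff xc' i) auto
        finally show ?thesis using 2 st by (simp add: x'_def L)
      next
        case 3
        have i: "Suc s \<in> I" "Suc t \<in> I" using I'2 st 3 by auto
        have "face E (Suc L) s (x' t) = face E (Suc L) (Suc s - 1) (face E (Suc (Suc L)) k (x (Suc t)))"
          using 3 st by (simp add: x'_def L)
        also have "\<dots> = face E (Suc L) k (face E (Suc (Suc L)) (Suc s) (x (Suc t)))"
          using 3 st I'le[OF st(2)] L by (intro ff[symmetric] xc' i) auto
        also have "\<dots> = face E (Suc L) k (face E (Suc (Suc L)) t (x (Suc s)))"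
          using xm'[OF i] st(3) by simp
        also have "\<dots> = face E (Suc L) (t - 1) (face E (Suc (Suc L)) k (x (Suc s)))"
          using 3 st I'le[OF st(2)] L by (intro ff xc' i) auto
        finally show ?thesis using 3 st by (simp add: x'_def L)
      qed
    qed
    then show "face E (Suc M - 1) s (x' t) = face E (Suc M - 1) (t - 1) (x' s)" by (simp add: L)
  qed
  moreover have "\<forall>t\<in>I'. face B (Suc M) t (face B m k y) = p (Suc M - 1) (x' t)"
  proof
    fix t assume t: "t \<in> I'"
    have y': "y \<in> scells B (Suc (Suc M))" using y by (simp add: M)
    show "face B (Suc M) t (face B m k y) = p (Suc M - 1) (x' t)"
    proof (cases "t < k")
      case True
      have "face B (Suc M) t (face B m k y) = face B (Suc M) (k - 1) (face B m t y)"
        using face_face[OF B True kM y'] by (simp add: M)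
      also have "\<dots> = face B (Suc M) (k - 1) (p (Suc M) (x t))"
        using xy I'1[OF t True] by (simp add: M)
      also have "\<dots> = p M (face E (Suc M) (k - 1) (x t))"
        using kM by (intro simplicial_map_face[OF p, symmetric] xc I'1[OF t True]) auto
      finally show ?thesis using True by (simp add: x'_def)
    next
      case False
      have *: "k < Suc t" "Suc t \<le> Suc (Suc M)" "Suc t \<in> I" using False I'le[OF t] I'2[OF t] by auto
      have "face B (Suc M) t (face B m k y) = face B (Suc M) k (face B m (Suc t) y)"
        using face_face[OF B *(1,2) y'] by (simp add: M)
      also have "\<dots> = face B (Suc M) k (p (Suc M) (x (Suc t)))"
        using xy * by (simp add: M)
      also have "\<dots> = p M (face E (Suc M) k (x (Suc t)))"
        using * by (intro simplicial_map_face[OF p, symmetric] xc) auto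
      finally show ?thesis using False by (simp add: x'_def)
    qed
  qed
  moreover have "face B m k y \<in> scells B (Suc M)"
    using face_closed[OF B kM] y by (simp add: M)
  ultimately obtain w where w: "w \<in> scells E (Suc M)" "\<forall>t\<in>I'. face E (Suc M) t w = x' t"
    "p (Suc M) w = face B m k y"
    using l1' unfolding lifts_def by blast
  define x2 where "x2 = x(k := w)"
  have x2I: "x2 i = x i" if "i \<in> I" for i using that k by (auto simp: x2_def)
  have lo: "face E (Suc M) i w = face E (Suc M) (k - 1) (x i)" if "i \<in> I" "i < k" for i
  proof -
    have "i \<in> I'" using that kM by (auto simp: I'_def coface_def M)
    then show ?thesis using w(2) that by (simp add: x'_def)
  qed
  have hi: "face E (Suc M) k (x j) = face E (Suc M) (j - 1) w" if "j \<in> I" "k < j" for j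
  proof -
    have "j - 1 \<in> I'" using that Ile[of j] by (auto simp: I'_def coface_def M)
    moreover have "\<not> j - 1 < k" "Suc (j - 1) = j" using that by auto
    ultimately show ?thesis using w(2) by (simp add: x'_def)
  qed
  have "matching E m (insert k I) x2"
    unfolding matching_def
  proof (intro conjI ballI impI)
    fix i assume "i \<in> insert k I"
    then show "x2 i \<in> scells E (m - 1)" using w(1) xc by (auto simp: x2_def M)
  next
    fix i j assume "i \<in> insert k I" "j \<in> insert k I" "i < j"
    then consider "i = k" "j \<in> I" "k < j" | "j = k" "i \<in> I" "i < k"
      | "i \<in> I" "j \<in> I" "i < j" using k by auto
    then have "face E (Suc M) i (x2 j) = face E (Suc M) (j - 1) (x2 i)"
    proof cases
      case 1
      then show ?thesis using hi[of j] x2I[of j] by (simp add: x2_def)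
    next
      case 2
      then show ?thesis using lo[of i] x2I[of i] by (simp add: x2_def)
    next
      case 3
      then show ?thesis using xm[of i j] x2I by simp
    qed
    then show "face E (m - 1) i (x2 j) = face E (m - 1) (j - 1) (x2 i)" by (simp add: M)
  qed
  moreover have "\<forall>i\<in>insert k I. face B m i y = p (m - 1) (x2 i)"
    using xy w(3) x2I by (auto simp: x2_def M)
  ultimately obtain z where z: "z \<in> scells E m" "\<forall>i\<in>insert k I. face E m i z = x2 i" "p m z = y"
    using l2 y unfolding lifts_def by blast
  then show "\<exists>z\<in>scells E m. (\<forall>i\<in>I. face E m i z = x i) \<and> p m z = y"
    using x2I by auto
qed

text \<open>Double induction: on the dimension and, within it, on the number of missing faces, with
  horns as the case of one missing face. Otherwise \<open>lifts_insert\<close> adds a missing face,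
  whose own partial boundary falls under the outer hypothesis.\<close>

lemma kan_fibration_lifts_partial_boundary:
  assumes fib: "kan_fibration E B p"
    and "1 \<le> m" "I \<subseteq> {..m}" "I \<noteq> {}" "I \<noteq> {..m}"
  shows "lifts E B p m I"
  using assms(2-)
proof (induction m arbitrary: I)
  case 0
  then show ?case by simp
next
  case (Suc m)
  have p: "simplicial_map E B p" and horns: "\<And>r. r \<le> Suc m \<Longrightarrow> lifts E B p (Suc m) ({..Suc m} - {r})"
    using fib by (auto simp: kan_fibration_iff_lifts)
  show ?case
    using Suc.prems(2-)
  proof (induction "card ({..Suc m} - I)" arbitrary: I rule: less_induct)
    case less
    show ?case
    proof (cases "\<exists>r\<le>Suc m. I = {..Suc m} - {r}")
      case True
      then show ?thesis using horns by auto
    next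
      case False
      obtain k where k: "k \<le> Suc m" "k \<notin> I" using less.prems by auto
      have ins: "insert k I \<noteq> {..Suc m}"
      proof
        assume "insert k I = {..Suc m}"
        then have "I = {..Suc m} - {k}" using k(2) by (metis Diff_insert_absorb)
        then show False using False k(1) by blast
      qed
      have "insert k I \<subseteq> {..Suc m}" using less.prems(1) k(1) by simp
      \<comment> \<open>A second missing vertex \<open>l\<close> keeps the partial boundary of the
        new face proper, and a vertex \<open>i\<close> in \<open>I\<close> keeps it nonempty. The
        three distinct vertices \<open>i\<close>, \<open>k\<close>, \<open>l\<close> also give
        \<open>1 \<le> m\<close>.\<close>
      then obtain l where l: "l \<in> {..Suc m}" "l \<notin> insert k I" using ins by blast
      then have l: "l \<le> Suc m" "l \<noteq> k" "l \<notin> I" by simp_all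
      obtain i where i: "i \<in> I" using less.prems by auto
      then have "i \<le> Suc m" using less.prems(1) by (meson atMost_iff subsetD)
      then have ik: "i \<le> Suc m" "i \<noteq> k" "i \<noteq> l" using i k l by metis+
      have m: "1 \<le> m" using k l ik by auto
      let ?I' = "{t. t \<le> m \<and> coface (Suc m) k t \<in> I}"
      have cf: "\<exists>t\<le>m. coface (Suc m) k t = u" if "u \<le> Suc m" "u \<noteq> k" for u
        using that k by (intro exI[of _ "if u < k then u else u - 1"]) (auto simp: coface_def)
      have "?I' \<noteq> {}" using cf[of i] ik i by auto
      moreover have "?I' \<noteq> {..m}"
      proof
        assume "?I' = {..m}"
        then have "coface (Suc m) k t \<in> I" if "t \<le> m" for t using that by auto
        then show False using cf[of l] l by auto
      qed
      ultimately have "lifts E B p m ?I'" using m by (intro Suc.IH) auto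
      moreover have "lifts E B p (Suc m) (insert k I)"
      proof (rule less.hyps)
        show "card ({..Suc m} - insert k I) < card ({..Suc m} - I)"
          using k by (intro psubset_card_mono) auto
      qed (use less.prems(1) ins k(1) in simp_all)
      ultimately show ?thesis
        using m k less.prems(1) by (intro lifts_insert[OF p, of "Suc m" I k]) simp_all
    qed
  qed
qed

section \<open>Coskeleta\<close>

lemma csk_closed:
  "\<phi> \<in> scells (csk N X) m \<Longrightarrow> k \<le> N \<Longrightarrow> h \<in> Delta k m \<Longrightarrow> \<phi> k h \<in> scells X k"
  by (force simp: csk_def PiE_iff)

lemma csk_natural:
  "\<phi> \<in> scells (csk N X) m \<Longrightarrow> k \<le> N \<Longrightarrow> l \<le> N \<Longrightarrow> f \<in> Delta k l \<Longrightarrow> h \<in> Delta l m \<Longrightarrow>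
    \<phi> k (compose {..k} h f) = sact X k l f (\<phi> l h)"
  by (simp add: csk_def)

lemma csk_cellI:
  assumes "\<And>k h. k \<le> N \<Longrightarrow> h \<in> Delta k m \<Longrightarrow> \<phi> k h \<in> scells X k"
    and "\<And>k l f h. k \<le> N \<Longrightarrow> l \<le> N \<Longrightarrow> f \<in> Delta k l \<Longrightarrow> h \<in> Delta l m \<Longrightarrow>
      \<phi> k (compose {..k} h f) = sact X k l f (\<phi> l h)"
  shows "(\<lambda>k\<in>{..N}. \<lambda>h\<in>Delta k m. \<phi> k h) \<in> scells (csk N X) m"
  using assms by (simp add: csk_def compose_in_Delta)

lemma csk_eqI:
  assumes "\<phi> \<in> scells (csk N X) m" "\<psi> \<in> scells (csk N X) m"
    and "\<And>k h. k \<le> N \<Longrightarrow> h \<in> Delta k m \<Longrightarrow> \<phi> k h = \<psi> k h"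
  shows "\<phi> = \<psi>"
proof (rule PiE_ext)
  show "\<phi> \<in> (\<Pi>\<^sub>E k\<in>{..N}. Delta k m \<rightarrow>\<^sub>E scells X k)" "\<psi> \<in> (\<Pi>\<^sub>E k\<in>{..N}. Delta k m \<rightarrow>\<^sub>E scells X k)"
    using assms(1,2) by (simp_all add: csk_def)
  then show "\<phi> k = \<psi> k" if "k \<in> {..N}" for k
    using that assms(3) by (intro PiE_ext[of "\<phi> k" "Delta k m"]) (auto dest: PiE_mem)
qed

lemma csk_act_apply:
  "k \<le> N \<Longrightarrow> h \<in> Delta k m \<Longrightarrow> sact (csk N X) m n g \<phi> k h = \<phi> k (compose {..k} g h)"
  by (simp add: csk_def)

lemma csk_act_closed:
  assumes "g \<in> Delta m n" "\<phi> \<in> scells (csk N X) n"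
  shows "sact (csk N X) m n g \<phi> \<in> scells (csk N X) m"
proof -
  have "(\<lambda>k\<in>{..N}. \<lambda>h\<in>Delta k m. \<phi> k (compose {..k} g h)) \<in> scells (csk N X) m"
    using assms csk_natural[OF assms(2)]
    by (intro csk_cellI csk_closed[OF assms(2)]) (simp_all add: compose_in_Delta compose_Delta_assoc)
  then show ?thesis by (simp add: csk_def)
qed

lemma csk_simplicial_set: "simplicial_set (csk N X)"
  unfolding simplicial_set_def
proof (intro conjI allI ballI funcsetI)
  fix m \<phi> assume \<phi>: "\<phi> \<in> scells (csk N X) m"
  show "sact (csk N X) m m (Delta_id m) \<phi> = \<phi>"
    by (rule csk_eqI[OF csk_act_closed[OF Delta_id_in \<phi>] \<phi>])
      (simp add: csk_act_apply compose_Delta_id_left)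
next
  fix k m n f g \<phi> assume *: "f \<in> Delta k m" "g \<in> Delta m n" "\<phi> \<in> scells (csk N X) n"
  show "sact (csk N X) k n (compose {..k} g f) \<phi> = sact (csk N X) k m f (sact (csk N X) m n g \<phi>)"
    using * by (intro csk_eqI[OF csk_act_closed csk_act_closed[OF _ csk_act_closed]])
      (simp_all add: csk_act_apply compose_in_Delta compose_Delta_assoc)
qed (rule csk_act_closed)

lemma csk_map_apply:
  "k \<le> N \<Longrightarrow> h \<in> Delta k m \<Longrightarrow> csk_map N p m \<phi> k h = p k (\<phi> k h)"
  by (simp add: csk_map_def)

lemma csk_map_closed:
  assumes "simplicial_map E B p" "\<phi> \<in> scells (csk N E) m"
  shows "csk_map N p m \<phi> \<in> scells (csk N B) m"
  unfolding csk_map_def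
  using assms
  by (intro csk_cellI) (auto simp: csk_closed csk_natural simplicial_map_closed simplicial_map_act)

lemma csk_map_simplicial_map:
  assumes p: "simplicial_map E B p"
  shows "simplicial_map (csk N E) (csk N B) (csk_map N p)"
  unfolding simplicial_map_def
proof (intro conjI allI ballI funcsetI csk_simplicial_set csk_map_closed[OF p])
  fix m n f \<phi> assume *: "f \<in> Delta m n" "\<phi> \<in> scells (csk N E) n"
  show "csk_map N p m (sact (csk N E) m n f \<phi>) = sact (csk N B) m n f (csk_map N p n \<phi>)"
    using * by (intro csk_eqI[OF csk_map_closed[OF p csk_act_closed] csk_act_closed[OF _ csk_map_closed[OF p]]])
      (simp_all add: csk_act_apply csk_map_apply compose_in_Delta)
qed

lemma csk_face_apply:
  "k \<le> N \<Longrightarrow> h \<in> Delta k m \<Longrightarrow>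
    face (csk N X) (Suc m) i \<phi> k h = \<phi> k (compose {..k} (coface (Suc m) i) h)"
  by (simp add: face_def csk_act_apply)

section \<open>The unit from a simplicial set to its coskeleton, and lifting in coskeleta\<close>

definition yoneda :: "nat \<Rightarrow> 'a sset \<Rightarrow> nat \<Rightarrow> 'a \<Rightarrow> nat \<Rightarrow> (nat \<Rightarrow> nat) \<Rightarrow> 'a" where
  "yoneda N X m z = (\<lambda>k\<in>{..N}. \<lambda>h\<in>Delta k m. sact X k m h z)"

lemma yoneda_closed:
  "simplicial_set X \<Longrightarrow> z \<in> scells X m \<Longrightarrow> yoneda N X m z \<in> scells (csk N X) m"
  unfolding yoneda_def by (intro csk_cellI) (simp_all add: sact_closed sact_compose)

lemma yoneda_eval:
  assumes "simplicial_set X" "m \<le> N" "\<phi> \<in> scells (csk N X) m"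
  shows "yoneda N X m (\<phi> m (Delta_id m)) = \<phi>"
proof (rule csk_eqI[OF yoneda_closed[OF assms(1)] assms(3)])
  show "\<phi> m (Delta_id m) \<in> scells X m" using assms by (simp add: csk_closed Delta_id_in)
  fix k h assume kh: "k \<le> N" "h \<in> Delta k m"
  then show "yoneda N X m (\<phi> m (Delta_id m)) k h = \<phi> k h"
    using csk_natural[OF assms(3) kh(1) assms(2) kh(2) Delta_id_in]
    by (simp add: yoneda_def compose_Delta_id_left)
qed

text \<open>Both sides are the value of \<open>\<phi>\<close> at \<open>g\<close>.\<close>

lemma eval_csk_act:
  assumes "m \<le> N" "n \<le> N" "g \<in> Delta m n" "\<phi> \<in> scells (csk N X) n"
  shows "sact (csk N X) m n g \<phi> m (Delta_id m) = sact X m n g (\<phi> n (Delta_id n))"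
  using csk_natural[OF assms(4,1-3) Delta_id_in] assms
  by (simp add: csk_act_apply Delta_id_in compose_Delta_id_left compose_Delta_id_right)

lemma csk_act_yoneda:
  assumes "simplicial_set X" "g \<in> Delta m n" "z \<in> scells X n"
  shows "sact (csk N X) m n g (yoneda N X n z) = yoneda N X m (sact X m n g z)"
  using assms
  by (intro csk_eqI[OF csk_act_closed[OF _ yoneda_closed] yoneda_closed[OF _ sact_closed]])
    (simp_all add: csk_act_apply yoneda_def compose_in_Delta sact_compose)

lemma csk_map_yoneda:
  assumes p: "simplicial_map E B p" and z: "z \<in> scells E m"
  shows "csk_map N p m (yoneda N E m z) = yoneda N B m (p m z)"
  using z simplicial_map_sets[OF p]
  by (intro csk_eqI[OF csk_map_closed[OF p yoneda_closed] yoneda_closed[OF _ simplicial_map_closed[OF p]]])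
    (simp_all add: csk_map_apply yoneda_def simplicial_map_act[OF p])

text \<open>Up to dimension \<open>N\<close> the unit \<open>yoneda\<close> is a bijection with
  inverse the evaluation at the identity. A lifting problem is evaluated, solved for
  \<open>p\<close>, and carried back along the unit.\<close>

lemma lifts_csk_le:
  assumes p: "simplicial_map E B p" and m: "1 \<le> m" "m \<le> N" and I: "I \<subseteq> {..m}"
    and l: "lifts E B p m I"
  shows "lifts (csk N E) (csk N B) (csk_map N p) m I"
  unfolding lifts_def
proof (intro allI ballI impI)
  fix x y
  assume y: "y \<in> scells (csk N B) m" and x: "matching (csk N E) m I x"
    and xy: "\<forall>i\<in>I. face (csk N B) m i y = csk_map N p (m - 1) (x i)"
  obtain M where M: "m = Suc M" using m by (cases m) auto
  note E = simplicial_map_sets(1)[OF p] and B = simplicial_map_sets(2)[OF p]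
  have xc: "x i \<in> scells (csk N E) M" if "i \<in> I" for i using x that by (simp add: matching_def M)
  have ile: "i \<le> Suc M" if "i \<in> I" for i using that I M by auto
  define e where "e i = x i M (Delta_id M)" for i
  have ev_face: "face X (Suc k) i (\<phi> (Suc k) (Delta_id (Suc k))) = face (csk N X) (Suc k) i \<phi> k (Delta_id k)"
    if "Suc k \<le> N" "i \<le> Suc k" "\<phi> \<in> scells (csk N X) (Suc k)" for X :: "'x sset" and k i \<phi>
    using that by (simp add: face_def eval_csk_act coface_in_Delta)
  have "matching E m I e"
    unfolding matching_def
  proof (intro conjI ballI impI)
    fix i assume "i \<in> I"
    then show "e i \<in> scells E (m - 1)"
      using csk_closed[OF xc _ Delta_id_in] m by (simp add: e_def M)
  next
    fix i j assume ij: "2 \<le> m" "i \<in> I" "j \<in> I" "i < j"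
    obtain L where L: "M = Suc L" using ij(1) M by (cases M) auto
    have "face (csk N E) (Suc L) i (x j) = face (csk N E) (Suc L) (j - 1) (x i)"
      using x ij M L by (simp add: matching_def)
    then show "face E (m - 1) i (e j) = face E (m - 1) (j - 1) (e i)"
      using ev_face[of L i "x j" E] ev_face[of L "j - 1" "x i" E] xc ij ile[of j] ile[of i] m
      by (simp add: e_def M L)
  qed
  moreover have "\<forall>i\<in>I. face B m i (y m (Delta_id m)) = p (m - 1) (e i)"
  proof
    fix i assume i: "i \<in> I"
    have "face B m i (y m (Delta_id m)) = face (csk N B) m i y M (Delta_id M)"
      using ev_face[of M i y B] y m ile[OF i] by (simp add: M)
    then show "face B m i (y m (Delta_id m)) = p (m - 1) (e i)"
      using xy i m by (simp add: M e_def csk_map_apply Delta_id_in)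
  qed
  moreover have "y m (Delta_id m) \<in> scells B m" using y m by (simp add: csk_closed Delta_id_in)
  ultimately obtain z where z: "z \<in> scells E m" "\<forall>i\<in>I. face E m i z = e i" "p m z = y m (Delta_id m)"
    using l unfolding lifts_def by blast
  have "face (csk N E) m i (yoneda N E m z) = x i" if i: "i \<in> I" for i
  proof -
    have "face (csk N E) m i (yoneda N E m z) = yoneda N E M (face E m i z)"
      using csk_act_yoneda[OF E coface_in_Delta[OF ile[OF i]], of z N] z(1) by (simp add: face_def M)
    also have "\<dots> = x i" using z(2) i yoneda_eval[OF E _ xc[OF i]] m by (simp add: e_def M)
    finally show ?thesis .
  qed
  moreover have "csk_map N p m (yoneda N E m z) = y"
    using csk_map_yoneda[OF p z(1)] z(3) yoneda_eval[OF B m(2) y] by simp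
  ultimately show "\<exists>z\<in>scells (csk N E) m. (\<forall>i\<in>I. face (csk N E) m i z = x i) \<and> csk_map N p m z = y"
    using yoneda_closed[OF E z(1)] by blast
qed

text \<open>
  Above dimension \<open>N\<close> the simplices of the \<open>N\<close>-skeleton of \<open>\<Delta>[m]\<close> all lie in its boundary, so
  that maps out of it can be glued from the faces.
\<close>

lemma lifts_csk_boundary:
  assumes p: "simplicial_map E B p" and m: "N < m"
  shows "lifts (csk N E) (csk N B) (csk_map N p) m {..m}"
  unfolding lifts_def
proof (intro allI ballI impI)
  fix x y
  assume y: "y \<in> scells (csk N B) m" and x: "matching (csk N E) m {..m} x"
    and xy: "\<forall>i\<in>{..m}. face (csk N B) m i y = csk_map N p (m - 1) (x i)"
  obtain M where M: "m = Suc M" using m by (cases m) auto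
  have xc: "x i \<in> scells (csk N E) M" if "i \<le> Suc M" for i using x that by (simp add: matching_def M)
  \<comment> \<open>Pigeonhole: at most \<open>N + 1\<close> values cannot cover the
    \<open>m + 1\<close> vertices.\<close>
  have omit: "\<exists>i\<le>Suc M. i \<notin> h ` {..k}" if "k \<le> N" for h :: "nat \<Rightarrow> nat" and k
  proof (rule ccontr)
    assume "\<not> ?thesis"
    then have "{..Suc M} \<subseteq> h ` {..k}" by auto
    then have "card {..Suc M} \<le> card {..k}" by (meson finite_atMost surj_card_le)
    then show False using that m M by simp
  qed
  \<comment> \<open>A map that omits both \<open>i\<close> and \<open>j\<close> factors through the
    codimension-two face they determine, and there the matching condition compares
    \<open>x i\<close> with \<open>x j\<close>.\<close>
  have indep: "x j k (cofactor k j h) = x i k (cofactor k i h)"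
    if kh: "k \<le> N" "h \<in> Delta k (Suc M)" and ij: "i < j" "j \<le> Suc M"
      and om: "i \<notin> h ` {..k}" "j \<notin> h ` {..k}" for i j k h
  proof -
    \<comment> \<open>The value \<open>h 0\<close> is a third vertex besides \<open>i\<close> and
      \<open>j\<close>, so \<open>2 \<le> m\<close> and the guarded condition in
      \<open>matching\<close> is in force.\<close>
    have "h 0 \<le> Suc M" "h 0 \<noteq> i" "h 0 \<noteq> j" using Delta_le[OF kh(2)] om by auto
    then obtain L where L: "M = Suc L" using ij by (cases M) auto
    define g where "g = cofactor k j h"
    have g: "g \<in> Delta k M" "compose {..k} (coface (Suc M) j) g = h"
      using cofactor_in_Delta[OF kh(2) ij(2) om(2)] compose_coface_cofactor[OF kh(2) ij(2) om(2)]
      by (simp_all add: g_def)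
    have "i \<notin> g ` {..k}" "i \<le> M"
    proof -
      show "i \<le> M" using ij by simp
      show "i \<notin> g ` {..k}"
      proof
        assume "i \<in> g ` {..k}"
        then obtain t where t: "t \<le> k" "g t = i" by auto
        then have "h t = i" using ij \<open>i \<le> M\<close> g(2) by (auto simp: compose_def coface_def)
        then show False using om t by auto
      qed
    qed
    define g' where "g' = cofactor k i g"
    have g': "g' \<in> Delta k L" "compose {..k} (coface (Suc L) i) g' = g"
      using cofactor_in_Delta[of g k L i] compose_coface_cofactor[of g k L i] \<open>i \<notin> g ` {..k}\<close> \<open>i \<le> M\<close> g
      by (simp_all add: g'_def L)
    have ci: "coface (Suc L) i \<in> Delta L M" "coface (Suc L) (j - 1) \<in> Delta L M"
      using coface_in_Delta[of i L] coface_in_Delta[of "j - 1" L] ij L by auto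
    have "h = compose {..k} (compose {..L} (coface (Suc M) j) (coface (Suc L) i)) g'"
      using g g' compose_Delta_assoc[OF g'(1)] by metis
    also have "\<dots> = compose {..k} (compose {..L} (coface (Suc M) i) (coface (Suc L) (j - 1))) g'"
      using coface_coface[of i j L] ij L by simp
    also have "\<dots> = compose {..k} (coface (Suc M) i) (compose {..k} (coface (Suc L) (j - 1)) g')"
      using compose_Delta_assoc[OF g'(1)] by metis
    finally have "cofactor k i h = compose {..k} (coface (Suc L) (j - 1)) g'"
      using cofactor_compose_coface[of "compose {..k} (coface (Suc L) (j - 1)) g'" k M i]
        compose_in_Delta[OF g'(1) ci(2)] by simp
    moreover have "face (csk N E) (Suc L) i (x j) = face (csk N E) (Suc L) (j - 1) (x i)"
      using x ij M L by (simp add: matching_def)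
    ultimately show ?thesis
      using csk_face_apply[OF kh(1) g'(1), of E i "x j"] csk_face_apply[OF kh(1) g'(1), of E "j - 1" "x i"] g'(2)
      by (simp add: g_def)
  qed
  \<comment> \<open>Each \<open>h\<close> is evaluated on some face that contains its image; by
    \<open>indep\<close> the choice does not matter.\<close>
  define \<Phi> where "\<Phi> k h = (let i = SOME i. i \<le> Suc M \<and> i \<notin> h ` {..k} in x i k (cofactor k i h))"
    for k and h :: "nat \<Rightarrow> nat"
  have \<Phi>: "\<Phi> k h = x i k (cofactor k i h)"
    if "k \<le> N" "h \<in> Delta k (Suc M)" "i \<le> Suc M" "i \<notin> h ` {..k}" for k h i
  proof -
    define j where "j = (SOME i. i \<le> Suc M \<and> i \<notin> h ` {..k})"
    have j: "j \<le> Suc M" "j \<notin> h ` {..k}"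
      using someI[of "\<lambda>i. i \<le> Suc M \<and> i \<notin> h ` {..k}", OF conjI[OF that(3,4)]]
      unfolding j_def by blast+
    have "x j k (cofactor k j h) = x i k (cofactor k i h)"
    proof (cases i j rule: linorder_cases)
      case less
      then show ?thesis using indep[OF that(1,2) less j(1) that(4) j(2)] by simp
    next
      case greater
      then show ?thesis using indep[OF that(1,2) greater that(3) j(2) that(4)] by simp
    qed simp
    then show ?thesis by (simp add: \<Phi>_def Let_def j_def)
  qed
  define \<phi> where "\<phi> = (\<lambda>k\<in>{..N}. \<lambda>h\<in>Delta k m. \<Phi> k h)"
  have \<phi>: "\<phi> \<in> scells (csk N E) m"
    unfolding \<phi>_def
  proof (rule csk_cellI)
    fix k h assume kh: "k \<le> N" "h \<in> Delta k m"
    obtain i where i: "i \<le> Suc M" "i \<notin> h ` {..k}" using omit[OF kh(1)] by blast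
    then show "\<Phi> k h \<in> scells E k"
      using kh \<Phi>[of k h i] csk_closed[OF xc[OF i(1)] kh(1) cofactor_in_Delta[of h k M i]] M by simp
  next
    fix k l f h assume *: "k \<le> N" "l \<le> N" "f \<in> Delta k l" "h \<in> Delta l m"
    obtain i where i: "i \<le> Suc M" "i \<notin> h ` {..l}" using omit[OF *(2)] by blast
    have h: "h \<in> Delta l (Suc M)" using * M by simp
    \<comment> \<open>A vertex omitted by \<open>h\<close> is omitted by the composite, so the one
      face \<open>x i\<close> computes both sides and its naturality suffices.\<close>
    have "i \<notin> compose {..k} h f ` {..k}"
      using i(2) Delta_le[OF *(3)] by (auto simp: compose_def)
    then have "\<Phi> k (compose {..k} h f) = x i k (compose {..k} (cofactor l i h) f)"
      using \<Phi>[OF *(1) compose_in_Delta[OF *(3) h] i(1)] cofactor_compose[OF *(3)] by simp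
    also have "\<dots> = sact E k l f (x i l (cofactor l i h))"
      using csk_natural[OF xc[OF i(1)] *(1-3) cofactor_in_Delta[OF h i]] .
    finally show "\<Phi> k (compose {..k} h f) = sact E k l f (\<Phi> l h)"
      using \<Phi>[OF *(2) h i] by simp
  qed
  have "face (csk N E) m i \<phi> = x i" if i: "i \<le> Suc M" for i
  proof (rule csk_eqI[OF _ xc[OF i]])
    show "face (csk N E) m i \<phi> \<in> scells (csk N E) M"
      using face_closed[OF csk_simplicial_set i] \<phi> M by simp
    fix k h assume kh: "k \<le> N" "h \<in> Delta k M"
    have "face (csk N E) m i \<phi> k h = \<Phi> k (compose {..k} (coface (Suc M) i) h)"
      using kh compose_in_Delta[OF kh(2) coface_in_Delta[OF i]] by (simp add: M csk_face_apply \<phi>_def)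
    also have "\<dots> = x i k h"
      using \<Phi>[OF kh(1) compose_in_Delta[OF kh(2) coface_in_Delta[OF i]] i coface_omits[OF kh(2)]]
      by (simp add: cofactor_compose_coface[OF kh(2)])
    finally show "face (csk N E) m i \<phi> k h = x i k h" .
  qed
  moreover have "csk_map N p m \<phi> = y"
  proof (rule csk_eqI[OF csk_map_closed[OF p \<phi>] y])
    fix k h assume kh: "k \<le> N" "h \<in> Delta k m"
    obtain i where i: "i \<le> Suc M" "i \<notin> h ` {..k}" using omit[OF kh(1)] by blast
    have h: "h \<in> Delta k (Suc M)" using kh M by simp
    note c = cofactor_in_Delta[OF h i]
    have "csk_map N p m \<phi> k h = csk_map N p M (x i) k (cofactor k i h)"
      using kh \<Phi>[OF kh(1) h i] c by (simp add: csk_map_apply \<phi>_def)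
    also have "\<dots> = face (csk N B) (Suc M) i y k (cofactor k i h)" using xy i M by simp
    also have "\<dots> = y k h"
      by (simp add: csk_face_apply[OF kh(1) c] compose_coface_cofactor[OF h i])
    finally show "csk_map N p m \<phi> k h = y k h" .
  qed
  ultimately show "\<exists>z\<in>scells (csk N E) m. (\<forall>i\<in>{..m}. face (csk N E) m i z = x i) \<and> csk_map N p m z = y"
    using \<phi> M by auto
qed

theorem kan_fibration_csk:
  assumes p: "simplicial_map E B p" and N: "1 \<le> N"
    and horns: "\<And>m r. 1 \<le> m \<Longrightarrow> m \<le> N \<Longrightarrow> r \<le> m \<Longrightarrow> lifts E B p m ({..m} - {r})"
    and boundary: "lifts E B p N {..N}"
  shows "kan_fibration (csk N E) (csk N B) (csk_map N p)"
  unfolding kan_fibration_iff_lifts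
proof (intro conjI allI impI csk_map_simplicial_map[OF p])
  fix m r :: nat assume m: "1 \<le> m" "r \<le> m"
  show "lifts (csk N E) (csk N B) (csk_map N p) m ({..m} - {r})"
  proof (cases "m \<le> N")
    case True
    then show ?thesis using m by (intro lifts_csk_le[OF p] horns) auto
  next
    case False
    show ?thesis
    proof (rule lifts_insert[OF csk_map_simplicial_map[OF p]])
      \<comment> \<open>Since \<open>coface m r\<close> never takes the value \<open>r\<close>, the
        partial boundary induced on the missing face is its whole boundary.\<close>
      have "{t. t \<le> m - 1 \<and> coface m r t \<in> {..m} - {r}} = {..m - 1}"
        using m by (auto simp: coface_def)
      moreover have "lifts (csk N E) (csk N B) (csk_map N p) (m - 1) {..m - 1}"
      \<comment> \<open>The missing face has dimension at least \<open>N\<close>. For equality its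
        boundary lies in the range where the coskeleton agrees with the original, and the assumption
        \<open>boundary\<close> applies; above that, boundaries lift for free.\<close>
      proof (cases "m - 1 = N")
        case True
        then show ?thesis using lifts_csk_le[OF p N order_refl _ boundary] by simp
      next
        case neq: False
        show ?thesis using False neq by (intro lifts_csk_boundary[OF p]) linarith
      qed
      ultimately show "lifts (csk N E) (csk N B) (csk_map N p) (m - 1)
          {t. t \<le> m - 1 \<and> coface m r t \<in> {..m} - {r}}"
        by simp
      have "insert r ({..m} - {r}) = {..m}" using m(2) by auto
      then show "lifts (csk N E) (csk N B) (csk_map N p) m (insert r ({..m} - {r}))"
        using lifts_csk_boundary[OF p] False by simp
    qed (use m False N in auto)
  qed
qed

section \<open>Kan complexes as fibrations over the point\<close>

definition point :: "unit sset" where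
  "point = \<lparr> scells = (\<lambda>_. {()}), sact = (\<lambda>_ _ _ _. ()) \<rparr>"

lemma simplicial_map_point: "simplicial_set X \<Longrightarrow> simplicial_map X point (\<lambda>_ _. ())"
  by (simp add: simplicial_map_def simplicial_set_def point_def)

lemma kan_fibration_point: "kan_complex X \<Longrightarrow> kan_fibration X point (\<lambda>_ _. ())"
  using simplicial_map_point[of X]
  unfolding kan_fibration_def kan_complex_def by (auto simp: point_def)

text \<open>Over a base with one simplex in each degree, compatibility with the base is automatic.
  The base is not fixed to be \<open>point\<close>, because applying a coskeleton to a map into
  \<open>point\<close> changes the target to \<open>csk N point\<close>.\<close>

lemma kan_complex_if_fibration:
  assumes fib: "kan_fibration E B p" and B: "\<And>m. \<exists>b. scells B m = {b}"
  shows "kan_complex E"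
  unfolding kan_complex_def
proof (intro conjI allI impI)
  have p: "simplicial_map E B p" using fib by (simp add: kan_fibration_def)
  then show "simplicial_set E" by (rule simplicial_map_sets)
  fix m r x assume h: "horn E m r x"
  obtain M where M: "m = Suc M" using h by (cases m) (auto simp: horn_def)
  obtain b where b: "b \<in> scells B m" using B[of m] by auto
  have "face B m i b = p (m - 1) (x i)" if i: "i \<in> {..m} - {r}" for i
  proof -
    obtain b' where b': "scells B M = {b'}" using B by blast
    have "face B m i b \<in> scells B M"
      using face_closed[OF simplicial_map_sets(2)[OF p], of i M b] i b M by simp
    moreover have "p M (x i) \<in> scells B M"
      using h i M by (intro simplicial_map_closed[OF p]) (auto simp: horn_def)
    ultimately show ?thesis using b' M by simp
  qed
  then show "\<exists>z\<in>scells E m. \<forall>i\<in>{..m} - {r}. face E m i z = x i"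
    using fib h b unfolding kan_fibration_def by blast
qed

lemma csk_point: "\<exists>b. scells (csk N point) m = {b}"
proof -
  have "(\<lambda>k\<in>{..N}. \<lambda>h\<in>Delta k m. ()) \<in> scells (csk N point) m"
    by (rule csk_cellI) (simp_all add: point_def)
  moreover have "\<phi> = \<psi>" if "\<phi> \<in> scells (csk N point) m" "\<psi> \<in> scells (csk N point) m" for \<phi> \<psi>
    using csk_eqI[OF that] by simp
  ultimately show ?thesis by blast
qed

section \<open>Vertical coskeleta of bisimplicial sets\<close>

text \<open>Record equality is too strong here: a column of \<open>vertical_csk N W\<close> acts
  through an additional \<open>csk_map\<close> of a horizontal identity, which is the identity only
  on simplices. Kan conditions look at actions on simplices only, so they transfer along this weaker
  relation.\<close>

definition sset_agree :: "'a sset \<Rightarrow> 'a sset \<Rightarrow> bool" where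
  "sset_agree X Y \<longleftrightarrow> scells X = scells Y \<and>
     (\<forall>m n. \<forall>f\<in>Delta m n. \<forall>x\<in>scells X n. sact X m n f x = sact Y m n f x)"

lemma sset_agree_cells: "sset_agree X Y \<Longrightarrow> scells X = scells Y"
  by (simp add: sset_agree_def)

lemma sset_agree_act:
  "sset_agree X Y \<Longrightarrow> f \<in> Delta m n \<Longrightarrow> x \<in> scells Y n \<Longrightarrow> sact Y m n f x = sact X m n f x"
  by (simp add: sset_agree_def)

lemma sset_agree_face:
  "sset_agree X Y \<Longrightarrow> i \<le> Suc m \<Longrightarrow> x \<in> scells Y (Suc m) \<Longrightarrow> face Y (Suc m) i x = face X (Suc m) i x"
  by (simp add: face_def sset_agree_act coface_in_Delta)

lemma simplicial_set_agree:
  assumes "sset_agree X Y" "simplicial_set X"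
  shows "simplicial_set Y"
  unfolding simplicial_set_def
proof (intro conjI allI ballI funcsetI)
  note ag = assms(1) and c = sset_agree_cells[OF assms(1)]
  fix m n f x assume "f \<in> Delta m n" "x \<in> scells Y n"
  then show "sact Y m n f x \<in> scells Y m"
    using sact_closed[OF assms(2), of f m n x] by (simp add: sset_agree_act[OF ag] c)
next
  note ag = assms(1) and c = sset_agree_cells[OF assms(1)]
  fix m x assume "x \<in> scells Y m"
  then show "sact Y m m (Delta_id m) x = x"
    using sact_id[OF assms(2), of x m] by (simp add: sset_agree_act[OF ag Delta_id_in] c)
next
  note ag = assms(1) and c = sset_agree_cells[OF assms(1)]
  fix k m n f g x assume *: "f \<in> Delta k m" "g \<in> Delta m n" "x \<in> scells Y n"
  then have "sact X m n g x \<in> scells Y m" using sact_closed[OF assms(2), of g m n x] by (simp add: c)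
  with * show "sact Y k n (compose {..k} g f) x = sact Y k m f (sact Y m n g x)"
    using sact_compose[OF assms(2) *(1,2), of x] compose_in_Delta[OF *(1,2)]
    by (simp add: sset_agree_act[OF ag] c)
qed

lemma kan_fibration_agree:
  assumes fib: "kan_fibration E B p" and E: "sset_agree E E'" and B: "sset_agree B B'"
    and pp: "\<And>m x. x \<in> scells E m \<Longrightarrow> p' m x = p m x"
  shows "kan_fibration E' B' p'"
  unfolding kan_fibration_def
proof (intro conjI allI ballI impI)
  have p: "simplicial_map E B p" using fib by (simp add: kan_fibration_def)
  note Ec = sset_agree_cells[OF E] and Bc = sset_agree_cells[OF B]
  show "simplicial_map E' B' p'"
    unfolding simplicial_map_def
  proof (intro conjI allI ballI funcsetI)
    show "simplicial_set E'" "simplicial_set B'"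
      using simplicial_set_agree E B simplicial_map_sets[OF p] by blast+
    show "p' m x \<in> scells B' m" if "x \<in> scells E' m" for m x
      using that simplicial_map_closed[OF p, of x m] pp[of x m] by (simp add: Ec Bc)
    fix m n f x assume *: "f \<in> Delta m n" "x \<in> scells E' n"
    have "p' n x \<in> scells B' n"
      using * simplicial_map_closed[OF p, of x n] pp[of x n] by (simp add: Ec Bc)
    moreover have "sact E m n f x \<in> scells E m"
      using * sact_closed[OF simplicial_map_sets(1)[OF p]] by (simp add: Ec)
    ultimately show "p' m (sact E' m n f x) = sact B' m n f (p' n x)"
      using * simplicial_map_act[OF p *(1), of x] pp
      by (simp add: sset_agree_act[OF E] sset_agree_act[OF B] Ec)
  qed
  fix m r x y
  assume y: "y \<in> scells B' m"
    and "horn E' m r x \<and> (\<forall>i\<in>{..m} - {r}. face B' m i y = p' (m - 1) (x i))"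
  then have h: "horn E' m r x" and xy: "\<forall>i\<in>{..m} - {r}. face B' m i y = p' (m - 1) (x i)" by auto
  obtain M where M: "m = Suc M" using h by (cases m) (auto simp: horn_def)
  have xc: "x i \<in> scells E' M" if "i \<in> {..m} - {r}" for i
    using h that by (auto simp: horn_def M)
  have "face E M i (x j) = face E M (j - 1) (x i)"
    if ij: "i \<in> {..m} - {r}" "j \<in> {..m} - {r}" "i < j" for i j
  proof -
    have rm: "r \<le> m" using h by (simp add: horn_def)
    \<comment> \<open>Two distinct faces besides the missing one force \<open>2 \<le> m\<close>, so
      the faces compared are faces of simplices of positive dimension.\<close>
    obtain L where L: "M = Suc L" using ij rm M by (cases M) auto
    have "face E' M i (x j) = face E' M (j - 1) (x i)" using h ij by (auto simp: horn_def M)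
    moreover have "i \<le> Suc L" "j - 1 \<le> Suc L" using ij M L by auto
    ultimately show ?thesis
      using xc[OF ij(1)] xc[OF ij(2)] sset_agree_face[OF E, of i L "x j"] sset_agree_face[OF E, of "j - 1" L "x i"]
      by (simp add: L M)
  qed
  then have "horn E m r x" using h by (auto simp: horn_def Ec M)
  moreover have "\<forall>i\<in>{..m} - {r}. face B m i y = p (m - 1) (x i)"
    using xy xc sset_agree_face[OF B, of _ M y] y pp[of _ M] by (auto simp: M Ec)
  ultimately obtain z where z: "z \<in> scells E m" "\<forall>i\<in>{..m} - {r}. face E m i z = x i" "p m z = y"
    using fib y unfolding kan_fibration_def Bc by blast
  then show "\<exists>z\<in>scells E' m. (\<forall>i\<in>{..m} - {r}. face E' m i z = x i) \<and> p' m z = y"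
    using sset_agree_face[OF E, of _ M z] pp[of z m] by (intro bexI[of _ z]) (auto simp: M Ec)
qed

lemma kan_complex_agree:
  assumes "kan_complex X" "sset_agree X Y"
  shows "kan_complex Y"
proof (rule kan_complex_if_fibration)
  show "kan_fibration Y point (\<lambda>_ _. ())"
    using assms by (intro kan_fibration_agree[OF kan_fibration_point]) (auto simp: sset_agree_def)
qed (simp add: point_def)

text \<open>Functoriality is stated for pairs of operators. Identities in one direction yield the
  simplicial structure of the columns and the commutation of horizontal with vertical
  operators.\<close>

definition bisimplicial_set :: "'a bisset \<Rightarrow> bool" where
  "bisimplicial_set W \<longleftrightarrow>
     (\<forall>k l k' l'. \<forall>f\<in>Delta k k'. \<forall>g\<in>Delta l l'. \<forall>x\<in>bcells W k' l'.
        bact W k l k' l' f g x \<in> bcells W k l) \<and>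
     (\<forall>k l. \<forall>x\<in>bcells W k l. bact W k l k l (Delta_id k) (Delta_id l) x = x) \<and>
     (\<forall>k l k' l' k'' l''. \<forall>f\<in>Delta k k'. \<forall>f'\<in>Delta k' k''. \<forall>g\<in>Delta l l'. \<forall>g'\<in>Delta l' l''.
        \<forall>x\<in>bcells W k'' l''. bact W k l k'' l'' (compose {..k} f' f) (compose {..l} g' g) x =
          bact W k l k' l' f g (bact W k' l' k'' l'' f' g' x))"

lemma bact_closed:
  "bisimplicial_set W \<Longrightarrow> f \<in> Delta k k' \<Longrightarrow> g \<in> Delta l l' \<Longrightarrow> x \<in> bcells W k' l' \<Longrightarrow>
    bact W k l k' l' f g x \<in> bcells W k l"
  unfolding bisimplicial_set_def by (elim conjE) simp

lemma bact_id:
  "bisimplicial_set W \<Longrightarrow> x \<in> bcells W k l \<Longrightarrow> bact W k l k l (Delta_id k) (Delta_id l) x = x"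
  unfolding bisimplicial_set_def by (elim conjE) simp

lemma bact_compose:
  "bisimplicial_set W \<Longrightarrow> f \<in> Delta k k' \<Longrightarrow> f' \<in> Delta k' k'' \<Longrightarrow> g \<in> Delta l l' \<Longrightarrow> g' \<in> Delta l' l'' \<Longrightarrow>
    x \<in> bcells W k'' l'' \<Longrightarrow> bact W k l k'' l'' (compose {..k} f' f) (compose {..l} g' g) x =
      bact W k l k' l' f g (bact W k' l' k'' l'' f' g' x)"
  unfolding bisimplicial_set_def by (elim conjE) simp

lemma simplicial_set_vertical:
  assumes W: "bisimplicial_set W"
  shows "simplicial_set (vertical W k)"
  unfolding simplicial_set_def vertical_def
proof (simp, intro conjI allI ballI funcsetI)
  fix l m n f g x
  assume *: "f \<in> Delta l m" "g \<in> Delta m n" "x \<in> bcells W k n"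
  show "bact W k l k n (Delta_id k) (compose {..l} g f) x =
    bact W k l k m (Delta_id k) f (bact W k m k n (Delta_id k) g x)"
    using bact_compose[OF W Delta_id_in[of k] Delta_id_in *]
    by (simp add: compose_Delta_id_left[OF Delta_id_in])
qed (use bact_closed[OF W Delta_id_in] bact_id[OF W] in auto)

lemma simplicial_map_horizontal:
  assumes W: "bisimplicial_set W" and f: "f \<in> Delta k k'"
  shows "simplicial_map (vertical W k') (vertical W k) (horizontal_map W k k' f)"
  unfolding simplicial_map_def
proof (intro conjI allI ballI funcsetI simplicial_set_vertical[OF W])
  show "horizontal_map W k k' f m x \<in> scells (vertical W k) m" if "x \<in> scells (vertical W k') m" for m x
    using that bact_closed[OF W f Delta_id_in] by (simp add: vertical_def horizontal_map_def)
  fix m n g x assume *: "g \<in> Delta m n" "x \<in> scells (vertical W k') n"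
  have x: "x \<in> bcells W k' n" using *(2) by (simp add: vertical_def)
  \<comment> \<open>Both sides are the action of the pair \<open>(f, g)\<close>, split in its two
    possible ways.\<close>
  show "horizontal_map W k k' f m (sact (vertical W k') m n g x) =
    sact (vertical W k) m n g (horizontal_map W k k' f n x)"
    using bact_compose[OF W f Delta_id_in Delta_id_in *(1) x] bact_compose[OF W Delta_id_in f *(1) Delta_id_in x]
    by (simp add: vertical_def horizontal_map_def compose_Delta_id_left[OF *(1)] compose_Delta_id_right[OF *(1)]
        compose_Delta_id_left[OF f] compose_Delta_id_right[OF f])
qed

lemma csk_horizontal_id:
  assumes W: "bisimplicial_set W" and \<phi>: "\<phi> \<in> scells (csk N (vertical W k)) l"
  shows "csk_map N (horizontal_map W k k (Delta_id k)) l \<phi> = \<phi>"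
proof (rule csk_eqI[OF csk_map_closed[OF simplicial_map_horizontal[OF W Delta_id_in] \<phi>] \<phi>])
  fix r h assume "r \<le> N" "h \<in> Delta r l"
  then show "csk_map N (horizontal_map W k k (Delta_id k)) l \<phi> r h = \<phi> r h"
    using csk_closed[OF \<phi>] bact_id[OF W] by (simp add: csk_map_apply horizontal_map_def vertical_def)
qed

lemma sset_agree_vertical_csk:
  assumes W: "bisimplicial_set W"
  shows "sset_agree (csk N (vertical W k)) (vertical (vertical_csk N W) k)"
  unfolding sset_agree_def
proof (intro conjI allI ballI)
  fix m n f \<phi> assume "f \<in> Delta m n" "\<phi> \<in> scells (csk N (vertical W k)) n"
  then show "sact (csk N (vertical W k)) m n f \<phi> = sact (vertical (vertical_csk N W) k) m n f \<phi>"
    using csk_horizontal_id[OF W csk_act_closed]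
    unfolding vertical_def[of "vertical_csk N W"] by (simp add: vertical_csk_def)
next
  show "scells (csk N (vertical W k)) = scells (vertical (vertical_csk N W) k)"
    unfolding vertical_def[of "vertical_csk N W"] by (simp add: vertical_csk_def)
qed

lemma horizontal_map_vertical_csk:
  assumes "\<phi> \<in> scells (csk N (vertical W k')) l"
  shows "horizontal_map (vertical_csk N W) k k' f l \<phi> = csk_map N (horizontal_map W k k' f) l \<phi>"
  using sact_id[OF csk_simplicial_set assms]
  unfolding horizontal_map_def[of "vertical_csk N W"] by (simp add: vertical_csk_def)

lemma bisimplicial_set_bislice:
  assumes Z: "nfold_simplicial_set n Z" and ij: "i \<in> {1..n}" "j \<in> {1..n}" "i \<noteq> j"
    and a: "a \<in> ({1..n} - {i, j}) \<rightarrow>\<^sub>E UNIV"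
  shows "bisimplicial_set (bislice n Z i j a)"
proof -
  \<comment> \<open>The functor that pads with \<open>a\<close> and its identities in the other
    directions. Outside its domain \<open>a\<close> is \<open>undefined\<close>, but the entries at
    \<open>i\<close> and \<open>j\<close> are overwritten.\<close>
  define q where "q k l = a(i := k, j := l)" for k l
  define F where "F f g = (\<lambda>s\<in>{1..n}. Delta_id (a s))(i := f, j := g)" for f g
  have q: "q k l \<in> nDelta_obj n" for k l
    using a ij by (auto simp: q_def nDelta_obj_def PiE_iff extensional_def)
  have F: "F f g \<in> nDelta n (q k l) (q k' l')" if "f \<in> Delta k k'" "g \<in> Delta l l'" for f g k l k' l'
    using that ij by (auto simp: q_def F_def nDelta_def PiE_iff extensional_def Delta_id_in)
  have F_id: "F (Delta_id k) (Delta_id l) = nDelta_id n (q k l)" for k l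
    using ij by (auto simp: q_def F_def nDelta_id_def)
  have F_comp: "F (compose {..k} f' f) (compose {..l} g' g) = nDelta_comp n (q k l) (F f' g') (F f g)" for k l f f' g g'
    using ij by (auto simp: q_def F_def nDelta_comp_def compose_Delta_id_left[OF Delta_id_in])
  have Z1: "mact Z p q F z \<in> mcells Z p"
    if "p \<in> nDelta_obj n" "q \<in> nDelta_obj n" "F \<in> nDelta n p q" "z \<in> mcells Z q" for p q F z
    using Z that unfolding nfold_simplicial_set_def by blast
  have Z2: "mact Z p p (nDelta_id n p) z = z" if "p \<in> nDelta_obj n" "z \<in> mcells Z p" for p z
    using Z that unfolding nfold_simplicial_set_def by blast
  have Z3: "mact Z p r (nDelta_comp n p G F) z = mact Z p q F (mact Z q r G z)"
    if "p \<in> nDelta_obj n" "q \<in> nDelta_obj n" "r \<in> nDelta_obj n" "F \<in> nDelta n p q" "G \<in> nDelta n q r" "z \<in> mcells Z r"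
    for p q r F G z
    using Z that unfolding nfold_simplicial_set_def by blast
  have W: "bislice n Z i j a = \<lparr> bcells = \<lambda>k l. mcells Z (q k l), bact = \<lambda>k l k' l' f g. mact Z (q k l) (q k' l') (F f g) \<rparr>"
    by (simp add: bislice_def q_def F_def)
  show ?thesis
    unfolding bisimplicial_set_def W
  proof (simp, intro conjI allI ballI)
    show "mact Z (q k l) (q k' l') (F f g) x \<in> mcells Z (q k l)"
      if "f \<in> Delta k k'" "g \<in> Delta l l'" "x \<in> mcells Z (q k' l')" for k l k' l' f g x
      using that by (intro Z1 q F)
    show "mact Z (q k l) (q k l) (F (Delta_id k) (Delta_id l)) x = x" if "x \<in> mcells Z (q k l)" for k l x
      using that by (simp add: F_id Z2 q)
    show "mact Z (q k l) (q k'' l'') (F (compose {..k} f' f) (compose {..l} g' g)) x =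
        mact Z (q k l) (q k' l') (F f g) (mact Z (q k' l') (q k'' l'') (F f' g') x)"
      if "f \<in> Delta k k'" "f' \<in> Delta k' k''" "g \<in> Delta l l'" "g' \<in> Delta l' l''" "x \<in> mcells Z (q k'' l'')"
      for k l k' l' k'' l'' f f' g g' x
      unfolding F_comp using that by (intro Z3 q F)
  qed
qed

section \<open>Ordinal sums\<close>

lemma osum_offset_Suc: "1 \<le> s \<Longrightarrow> osum_offset p (Suc s) = osum_offset p s + p s + 1"
  by (simp add: osum_offset_def)

lemma osum_offset_less:
  assumes "1 \<le> s" "s < s'"
  shows "osum_offset p s + p s < osum_offset p s'"
proof -
  have "osum_offset p (Suc s) \<le> osum_offset p s'"
    unfolding osum_offset_def using assms by (intro sum_mono2) auto
  then show ?thesis using osum_offset_Suc[OF assms(1)] by simp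
qed

text \<open>The offset of a fictitious block after the last one counts all elements of the ordinal
  sum, hence the \<open>Suc\<close>. With it, bounds on the last block become instances of
  \<open>osum_offset_less\<close>.\<close>

lemma osum_offset_top:
  assumes "1 \<le> n"
  shows "osum_offset p (Suc n) = Suc (osum_obj n p)"
proof -
  have "(\<Sum>r\<in>{1..n}. p r + 1) = (\<Sum>r\<in>{1..n}. p r) + n"
    by (simp only: sum.distrib) simp
  then show ?thesis
    unfolding osum_offset_def osum_obj_def atLeastLessThanSuc_atLeastAtMost using assms by simp
qed

lemma osum_offset_le_obj:
  assumes "s \<in> {1..n}" "t \<le> p s"
  shows "osum_offset p s + t \<le> osum_obj n p"
  using osum_offset_less[of s "Suc n" p] osum_offset_top[of n p] assms by auto

lemma osum_cases:
  assumes "u \<le> osum_obj n p" "1 \<le> n"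
  obtains s t where "s \<in> {1..n}" "t \<le> p s" "u = osum_offset p s + t"
proof -
  \<comment> \<open>The bound is an offset rather than \<open>osum_obj\<close>, so that the
    induction can start at 0, where \<open>n - 1\<close> would be truncated.\<close>
  have "\<exists>s\<in>{1..n}. \<exists>t\<le>p s. u = osum_offset p s + t" if "u < osum_offset p (Suc n)" for n
    using that
  proof (induction n)
    case 0
    then show ?case by (simp add: osum_offset_def)
  next
    case (Suc n)
    show ?case
    proof (cases "u < osum_offset p (Suc n)")
      case True
      then obtain s t where "s \<in> {1..n}" "t \<le> p s" "u = osum_offset p s + t" using Suc.IH by blast
      then show ?thesis by (intro bexI[of _ s] exI[of _ t]) auto
    next
      case False
      then show ?thesis using Suc.prems osum_offset_Suc[of "Suc n" p]
        by (intro bexI[of _ "Suc n"] exI[of _ "u - osum_offset p (Suc n)"]) auto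
    qed
  qed
  then show thesis using assms osum_offset_top[of n p] that by (metis le_imp_less_Suc)
qed

lemma osum_unique:
  assumes "osum_offset p s + t = osum_offset p s' + t'" "t \<le> p s" "t' \<le> p s'" "1 \<le> s" "1 \<le> s'"
  shows "s = s'"
  using osum_offset_less[of s s' p] osum_offset_less[of s' s p] assms by (cases s s' rule: linorder_cases) auto

lemma osum_block_offset:
  assumes "s \<in> {1..n}" "t \<le> p s"
  shows "osum_block n p (osum_offset p s + t) = s"
  unfolding osum_block_def
proof (rule the_equality)
  fix s' assume s': "s' \<in> {1..n} \<and> osum_offset p s' \<le> osum_offset p s + t \<and>
    osum_offset p s + t \<le> osum_offset p s' + p s'"
  then show "s' = s"
    using osum_unique[of p s' "osum_offset p s + t - osum_offset p s'" s t] assms by auto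
qed (use assms in auto)

lemma osum_map_offset:
  "s \<in> {1..n} \<Longrightarrow> t \<le> p s \<Longrightarrow> osum_map n p q F (osum_offset p s + t) = osum_offset q s + F s t"
  by (simp add: osum_map_def osum_block_offset osum_offset_le_obj)

lemma osum_map_in_Delta:
  assumes n: "1 \<le> n" and F: "\<And>s. s \<in> {1..n} \<Longrightarrow> F s \<in> Delta (p s) (q s)"
  shows "osum_map n p q F \<in> Delta (osum_obj n p) (osum_obj n q)"
proof (rule DeltaI)
  fix u assume "u \<le> osum_obj n p"
  then obtain s t where st: "s \<in> {1..n}" "t \<le> p s" "u = osum_offset p s + t" using n by (rule osum_cases)
  then show "osum_map n p q F u \<le> osum_obj n q"
    using osum_offset_le_obj[where p = q, OF st(1) Delta_le[OF F[OF st(1)] st(2)]] by (simp add: osum_map_offset)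
next
  fix u v assume uv: "u \<le> v" "v \<le> osum_obj n p"
  then have "u \<le> osum_obj n p" by simp
  then obtain s t where st: "s \<in> {1..n}" "t \<le> p s" "u = osum_offset p s + t" using n by (rule osum_cases)
  obtain s' t' where st': "s' \<in> {1..n}" "t' \<le> p s'" "v = osum_offset p s' + t'" using uv(2) n by (rule osum_cases)
  note fl = Delta_le[OF F[OF st(1)] st(2)]
  have "osum_offset q s + F s t \<le> osum_offset q s' + F s' t'"
  proof (cases s s' rule: linorder_cases)
    case less
    then show ?thesis using osum_offset_less[of s s' q] st(1) fl by simp
  next
    case equal
    then show ?thesis using Delta_mono[OF F[OF st(1)], of t t'] st st' uv(1) by simp
  next
    case greater
    then show ?thesis using osum_offset_less[of s' s p] st st' uv(1) by simp
  qed
  then show "osum_map n p q F u \<le> osum_map n p q F v" using st st' by (simp add: osum_map_offset)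
qed (simp add: osum_map_def)

lemma osum_map_eqI:
  assumes "1 \<le> n" "f \<in> Delta (osum_obj n p) m" "f' \<in> Delta (osum_obj n p) m'"
    and "\<And>s t. s \<in> {1..n} \<Longrightarrow> t \<le> p s \<Longrightarrow> f (osum_offset p s + t) = f' (osum_offset p s + t)"
  shows "f = f'"
  using assms by (metis Delta_eqI osum_cases)

lemma nfold_simplicial_set_Or:
  assumes X: "simplicial_set X" and n: "1 \<le> n"
  shows "nfold_simplicial_set n (Or n X)"
  unfolding nfold_simplicial_set_def
proof (intro conjI ballI funcsetI)
  have FD: "F s \<in> Delta (p s) (q s)" if "F \<in> nDelta n p q" "s \<in> {1..n}" for F p q s
    using that by (auto simp: nDelta_def)
  note D = osum_map_in_Delta[OF n FD]
  show "mact (Or n X) p q F z \<in> mcells (Or n X) p" if "F \<in> nDelta n p q" "z \<in> mcells (Or n X) q" for p q F z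
    using that sact_closed[OF X D] by (simp add: Or_def)
  show "mact (Or n X) p p (nDelta_id n p) z = z" if z: "z \<in> mcells (Or n X) p" for p z
  proof -
    have "nDelta_id n p \<in> nDelta n p p" by (simp add: nDelta_def nDelta_id_def Delta_id_in)
    then have "osum_map n p p (nDelta_id n p) = Delta_id (osum_obj n p)"
      by (rule osum_map_eqI[OF n D Delta_id_in])
        (simp_all add: osum_map_offset nDelta_id_def Delta_id_def osum_offset_le_obj)
    then show ?thesis using z sact_id[OF X] by (simp add: Or_def)
  qed
  fix p q r F G z
  assume *: "F \<in> nDelta n p q" "G \<in> nDelta n q r" "z \<in> mcells (Or n X) r"
  have GF: "nDelta_comp n p G F \<in> nDelta n p r"
    using compose_in_Delta[OF FD[OF *(1)] FD[OF *(2)]] by (simp add: nDelta_def nDelta_comp_def)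
  have "osum_map n p r (nDelta_comp n p G F) =
      compose {..osum_obj n p} (osum_map n q r G) (osum_map n p q F)"
  proof (rule osum_map_eqI[OF n D[OF GF] compose_in_Delta[OF D[OF *(1)] D[OF *(2)]]])
    fix s t assume st: "s \<in> {1..n}" "t \<le> p s"
    have "F s t \<le> q s" using Delta_le[OF FD[OF *(1) st(1)] st(2)] .
    then show "osum_map n p r (nDelta_comp n p G F) (osum_offset p s + t) =
        compose {..osum_obj n p} (osum_map n q r G) (osum_map n p q F) (osum_offset p s + t)"
      using st osum_offset_le_obj[where p = p, OF st]
      by (simp add: osum_map_offset nDelta_comp_def compose_def)
  qed
  then show "mact (Or n X) p r (nDelta_comp n p G F) z = mact (Or n X) p q F (mact (Or n X) q r G z)"
    using sact_compose[OF X D[OF *(1)] D[OF *(2)]] *(3) by (simp add: Or_def)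
qed

section \<open>Shrinking one block of an ordinal sum\<close>

lemma osum_offset_upd_le: "s \<le> j \<Longrightarrow> osum_offset (q(j := m)) s = osum_offset q s"
  unfolding osum_offset_def by (intro sum.cong) auto

lemma osum_offset_upd_greater:
  assumes "j < s" "1 \<le> j" "q j = Suc m"
  shows "osum_offset q s = Suc (osum_offset (q(j := m)) s)"
proof -
  have j: "finite {1..<s}" "j \<in> {1..<s}" using assms by auto
  show ?thesis
    unfolding osum_offset_def sum.remove[OF j] using assms(3) by (simp cong: sum.cong_simp)
qed

lemma osum_obj_upd:
  assumes "j \<in> {1..n}" "q j = Suc m"
  shows "osum_obj n q = Suc (osum_obj n (q(j := m)))"
proof -
  have j: "finite {1..n}" using assms by auto
  show ?thesis
    unfolding osum_obj_def sum.remove[OF j assms(1)] using assms(2) by (simp cong: sum.cong_simp)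
qed

text \<open>Blocks before \<open>j\<close> stay in place and blocks after it move up by one, which
  is the effect of a coface omitting an element of block \<open>j\<close>. This turns face operators
  of either direction of a slice into single face operators of \<open>X\<close>.\<close>

lemma osum_map_coface:
  assumes j: "j \<in> {1..n}" and q: "q j = Suc m" and t: "t \<le> Suc m"
    and F: "\<And>s. s \<in> {1..n} \<Longrightarrow> F s = (if s = j then coface (Suc m) t else Delta_id (q s))"
  shows "osum_map n (q(j := m)) q F = coface (osum_obj n q) (osum_offset q j + t)"
proof -
  let ?p = "q(j := m)"
  have n: "1 \<le> n" using j by simp
  note obj = osum_obj_upd[where q = q, OF j q]
  have le: "osum_offset q j + t \<le> Suc (osum_obj n ?p)"
    using osum_offset_le_obj[OF j, of t q] q t obj by simp
  show ?thesis
  proof (rule osum_map_eqI[OF n])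
    show "osum_map n ?p q F \<in> Delta (osum_obj n ?p) (osum_obj n q)"
      by (rule osum_map_in_Delta[OF n]) (use F t coface_in_Delta Delta_id_in q in auto)
    show "coface (osum_obj n q) (osum_offset q j + t) \<in> Delta (osum_obj n ?p) (Suc (osum_obj n ?p))"
      unfolding obj by (rule coface_in_Delta[OF le])
    fix s v assume sv: "s \<in> {1..n}" "v \<le> ?p s"
    have v: "osum_offset ?p s + v \<le> osum_obj n q - 1"
      using osum_offset_le_obj[where p = ?p, OF sv] obj by simp
    have "osum_map n ?p q F (osum_offset ?p s + v) = osum_offset q s + F s v"
      by (rule osum_map_offset[where p = ?p, OF sv])
    also have "\<dots> = coface (osum_obj n q) (osum_offset q j + t) (osum_offset ?p s + v)"
    proof (cases s j rule: linorder_cases)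
      case less
      then have "osum_offset q s + v < osum_offset q j"
        using osum_offset_less[of s j q] sv by auto
      then show ?thesis using v less sv F[OF sv(1)] osum_offset_upd_le[of s j q m]
        by (auto simp: coface_def Delta_id_def)
    next
      case equal
      then show ?thesis using v sv F[OF sv(1)] osum_offset_upd_le[of s j q m]
        by (auto simp: coface_def)
    next
      case greater
      then have "osum_offset q j + t < osum_offset q s"
        using osum_offset_less[of j s q] j q t by auto
      then show ?thesis using v greater sv F[OF sv(1)] osum_offset_upd_greater[of j s q m] j q
        by (auto simp: coface_def Delta_id_def)
    qed
    finally show "osum_map n ?p q F (osum_offset ?p s + v) =
      coface (osum_obj n q) (osum_offset q j + t) (osum_offset ?p s + v)" .
  qed
qed

lemma horn_proper: "1 \<le> m \<Longrightarrow> r \<le> m \<Longrightarrow> {..m} - {r} \<noteq> {} \<and> {..m} - {r} \<noteq> {..m}" for m r :: nat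
  by (cases "r = 0") (auto simp: set_eq_iff)

section \<open>Bisimplicial slices of \<open>Or\<close>\<close>

locale or_slice =
  fixes X :: "'a sset" and n i j :: nat and a :: "nat \<Rightarrow> nat"
  assumes kan: "kan_complex X"
    and i: "i \<in> {1..n}" and j: "j \<in> {1..n}" and ij: "i \<noteq> j"
    and a: "a \<in> ({1..n} - {i, j}) \<rightarrow>\<^sub>E UNIV"
begin

definition W :: "'a bisset" where
  "W = bislice n (Or n X) i j a"

definition q :: "nat \<Rightarrow> nat \<Rightarrow> nat \<Rightarrow> nat" where
  "q k m = a(i := k, j := m)"

definition dim :: "nat \<Rightarrow> nat \<Rightarrow> nat" where
  "dim k m = osum_obj n (q k m)"

definition hoff :: "nat \<Rightarrow> nat \<Rightarrow> nat" where
  "hoff k m = osum_offset (q k m) i"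

definition voff :: "nat \<Rightarrow> nat \<Rightarrow> nat" where
  "voff k m = osum_offset (q k m) j"

lemma X: "simplicial_set X"
  using kan by (simp add: kan_complex_def)

lemma bisimplicial_set_W: "bisimplicial_set W"
  unfolding W_def using X i j ij a by (intro bisimplicial_set_bislice nfold_simplicial_set_Or) auto

lemma q_i: "q k m i = k" and q_j: "q k m j = m"
  using ij by (simp_all add: q_def)

lemma q_upd_i: "(q k m)(i := k') = q k' m" and q_upd_j: "(q k m)(j := m') = q k m'"
  using ij by (auto simp: q_def)

lemma vertical_cells: "scells (vertical W k) m = scells X (dim k m)"
  by (simp add: vertical_def W_def bislice_def Or_def dim_def q_def)

lemma dim_Suc: "dim (Suc k) m = Suc (dim k m)" "dim k (Suc m) = Suc (dim k m)"
  using osum_obj_upd[of i n "q (Suc k) m" k] osum_obj_upd[of j n "q k (Suc m)" m] i j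
  by (simp_all add: dim_def q_i q_j q_upd_i q_upd_j)

text \<open>Enlarging a block shifts only the blocks after it. Here the order of \<open>i\<close>
  and \<open>j\<close> enters, and with it the case distinctions in the mixed face
  identities.\<close>

lemma hoff_Suc: "hoff k (Suc m) = (if i < j then hoff k m else Suc (hoff k m))"
  using osum_offset_upd_le[of i j "q k (Suc m)" m] osum_offset_upd_greater[of j i "q k (Suc m)" m] ij j
  by (auto simp: hoff_def q_j q_upd_j)

lemma voff_Suc: "voff (Suc k) m = (if i < j then Suc (voff k m) else voff k m)"
  using osum_offset_upd_le[of j i "q (Suc k) m" k] osum_offset_upd_greater[of i j "q (Suc k) m" k] ij i
  by (auto simp: voff_def q_i q_upd_i)

lemma voff_cong: "voff k m = voff k m'"
  using osum_offset_upd_le[of j j "q k m" m'] by (simp add: voff_def q_upd_j)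

lemma hoff_le: "v \<le> k \<Longrightarrow> hoff k m + v \<le> dim k m"
  using osum_offset_le_obj[of i n v "q k m"] i by (simp add: hoff_def dim_def q_i)

lemma voff_le: "t \<le> m \<Longrightarrow> voff k m + t \<le> dim k m"
  using osum_offset_le_obj[of j n t "q k m"] j by (simp add: voff_def dim_def q_j)

lemma off_less: "i < j \<Longrightarrow> hoff k m + k < voff k m" "j < i \<Longrightarrow> voff k m + m < hoff k m"
  using osum_offset_less[of i j "q k m"] osum_offset_less[of j i "q k m"] i j
  by (simp_all add: hoff_def voff_def q_i q_j)

section \<open>Faces of the slice as faces of \<open>X\<close>, and lifting problems\<close>

lemma vertical_face:
  assumes "t \<le> Suc m"
  shows "face (vertical W k) (Suc m) t x = face X (dim k (Suc m)) (voff k (Suc m) + t) x"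
proof -
  let ?F = "(\<lambda>s\<in>{1..n}. Delta_id (a s))(i := Delta_id k, j := coface (Suc m) t)"
  have "osum_map n ((q k (Suc m))(j := m)) (q k (Suc m)) ?F =
      coface (osum_obj n (q k (Suc m))) (osum_offset (q k (Suc m)) j + t)"
    by (rule osum_map_coface[OF j _ assms]) (use ij in \<open>auto simp: q_def\<close>)
  moreover have "face (vertical W k) (Suc m) t x =
      sact X (dim k m) (dim k (Suc m)) (osum_map n (q k m) (q k (Suc m)) ?F) x"
    by (simp add: face_def vertical_def W_def bislice_def Or_def dim_def q_def)
  ultimately show ?thesis
    unfolding face_def voff_def by (simp add: q_upd_j dim_Suc(2) flip: dim_def)
qed

lemma horizontal_map_face:
  assumes "v \<le> Suc k"
  shows "horizontal_map W k (Suc k) (coface (Suc k) v) m x = face X (dim (Suc k) m) (hoff (Suc k) m + v) x"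
proof -
  let ?F = "(\<lambda>s\<in>{1..n}. Delta_id (a s))(i := coface (Suc k) v, j := Delta_id m)"
  have "osum_map n ((q (Suc k) m)(i := k)) (q (Suc k) m) ?F =
      coface (osum_obj n (q (Suc k) m)) (osum_offset (q (Suc k) m) i + v)"
    by (rule osum_map_coface[OF i _ assms]) (use ij in \<open>auto simp: q_def\<close>)
  moreover have "horizontal_map W k (Suc k) (coface (Suc k) v) m x =
      sact X (dim k m) (dim (Suc k) m) (osum_map n (q k m) (q (Suc k) m) ?F) x"
    by (simp add: horizontal_map_def W_def bislice_def Or_def dim_def q_def)
  ultimately show ?thesis
    unfolding face_def hoff_def by (simp add: q_upd_i dim_Suc(1) flip: dim_def)
qed

lemma fill:
  assumes "1 \<le> M" "J \<subseteq> {..M}" "J \<noteq> {}" "J \<noteq> {..M}" "matching X M J x"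
  shows "\<exists>z\<in>scells X M. \<forall>u\<in>J. face X M u z = x u"
  using kan_fibration_lifts_partial_boundary[OF kan_fibration_point[OF kan] assms(1-4)] assms(5)
  unfolding lifts_def point_def by simp

text \<open>For \<open>m = 0\<close> the predicate \<open>matching\<close> gives no equation for a
  pair of faces, while the corresponding faces in \<open>X\<close> do meet. Such a pair exhausts the
  faces of an edge, and this is the case that the disjunction excludes.\<close>

lemma vertical_matching:
  assumes x: "matching (vertical W k) (Suc m) I x" and I: "I \<subseteq> {..Suc m}"
    and m: "1 \<le> m \<or> I \<noteq> {..Suc m}"
    and st: "s \<in> I" "t \<in> I" "s < t"
  shows "face X (dim k m) (voff k m + s) (x t) = face X (dim k m) (voff k m + t - 1) (x s)"
proof -
  have "m \<noteq> 0"
  proof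
    assume m0: "m = 0"
    then have "t \<le> 1" using I st by auto
    then have "s = 0" "t = 1" using st(3) by auto
    then have "I = {..Suc m}" using I st m0 by (auto simp: atMost_Suc)
    then show False using m m0 by simp
  qed
  then obtain L where L: "m = Suc L" by (cases m) auto
  have st': "s \<le> Suc L" "t - 1 \<le> Suc L" using I st L by auto
  have "face (vertical W k) (Suc L) s (x t) = face (vertical W k) (Suc L) (t - 1) (x s)"
    using x st L by (simp add: matching_def)
  then show ?thesis using st st' by (simp add: vertical_face L)
qed

lemma lifts_vertical:
  assumes I: "I \<subseteq> {..Suc m}" "I \<noteq> {}" and m: "1 \<le> m \<or> I \<noteq> {..Suc m}"
  shows "lifts (vertical W k) point (\<lambda>_ _. ()) (Suc m) I"
  unfolding lifts_def
proof (intro allI ballI impI)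
  fix x :: "nat \<Rightarrow> 'a" and y :: unit
  assume x: "matching (vertical W k) (Suc m) I x"
  define c where "c = voff k (Suc m)"
  have c: "voff k m = c" unfolding c_def by (rule voff_cong)
  define J where "J = (+) c ` I"
  have le: "c + t \<le> dim k (Suc m)" if "t \<in> I" for t
    using voff_le[of t "Suc m" k] that I by (auto simp: c_def)
  \<comment> \<open>The first vertex of the block of \<open>i\<close> lies outside the block of
    \<open>j\<close>. Its opposite face stays missing even if \<open>I\<close> contains all vertices
    of the vertical simplex, so \<open>J\<close> is proper.\<close>
  have "hoff k (Suc m) \<notin> J"
    using off_less[of k "Suc m"] ij I by (cases "i < j") (auto simp: J_def c_def)
  then have "J \<noteq> {..dim k (Suc m)}" using hoff_le[of 0 k "Suc m"] by auto
  moreover have "matching X (dim k (Suc m)) J (\<lambda>u. x (u - c))"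
    unfolding matching_def
  proof (intro conjI ballI impI)
    fix u assume "u \<in> J"
    then show "x (u - c) \<in> scells X (dim k (Suc m) - 1)"
      using x by (auto simp: J_def matching_def vertical_cells dim_Suc)
  next
    fix u w assume uw: "u \<in> J" "w \<in> J" "u < w"
    then obtain s t where "s \<in> I" "t \<in> I" "s < t" "u = c + s" "w = c + t" by (auto simp: J_def)
    then show "face X (dim k (Suc m) - 1) u (x (w - c)) = face X (dim k (Suc m) - 1) (w - 1) (x (u - c))"
      using vertical_matching[OF x I(1) m] by (simp add: dim_Suc c)
  qed
  moreover have "J \<subseteq> {..dim k (Suc m)}" "J \<noteq> {}" "1 \<le> dim k (Suc m)"
    using I le by (auto simp: J_def dim_Suc)
  ultimately obtain z where "z \<in> scells X (dim k (Suc m))" "\<forall>u\<in>J. face X (dim k (Suc m)) u z = x (u - c)"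
    using fill[of "dim k (Suc m)" J "\<lambda>u. x (u - c)"] by blast
  then show "\<exists>z\<in>scells (vertical W k) (Suc m). (\<forall>t\<in>I. face (vertical W k) (Suc m) t z = x t) \<and> () = y"
    using I by (intro bexI[of _ z]) (auto simp: vertical_face subset_iff J_def c_def[symmetric] vertical_cells)
qed

text \<open>
  A lifting problem against the horizontal face \<open>v\<close> is a single partial boundary in \<open>X\<close>: the
  faces \<open>x t\<close> are opposite to vertices in the block of \<open>j\<close>, and \<open>y\<close> is opposite to vertex \<open>v\<close> of
  the block of \<open>i\<close>. That block has a further vertex, whose opposite face is missing.
\<close>

lemma lifts_horizontal:
  assumes I: "I \<subseteq> {..Suc m}" and m: "1 \<le> m \<or> I \<noteq> {..Suc m}" and v: "v \<le> Suc k"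
  shows "lifts (vertical W (Suc k)) (vertical W k) (horizontal_map W k (Suc k) (coface (Suc k) v)) (Suc m) I"
  unfolding lifts_def
proof (intro allI ballI impI)
  fix x y
  assume y: "y \<in> scells (vertical W k) (Suc m)" and x: "matching (vertical W (Suc k)) (Suc m) I x"
    and xy: "\<forall>t\<in>I. face (vertical W k) (Suc m) t y =
      horizontal_map W k (Suc k) (coface (Suc k) v) (Suc m - 1) (x t)"
  define c where "c = voff (Suc k) (Suc m)"
  define d where "d = hoff (Suc k) (Suc m) + v"
  have c: "voff (Suc k) m = c" unfolding c_def by (rule voff_cong)
  define N where "N = dim k (Suc m)"
  have N: "dim (Suc k) m = N" "dim (Suc k) (Suc m) = Suc N"
    by (simp_all add: N_def dim_Suc)
  have dc: "if i < j then d < c else c + Suc m < d"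
    using off_less[of "Suc k" "Suc m"] ij v by (auto simp: c_def d_def)
  have It: "t \<le> Suc m" if "t \<in> I" for t using that I by auto
  have xc: "x t \<in> scells X N" if "t \<in> I" for t
    using x that by (auto simp: matching_def vertical_cells N)
  \<comment> \<open>Compatibility of \<open>x t\<close> with \<open>y\<close> is the matching
    condition in \<open>X\<close> between the vertices \<open>c + t\<close> and \<open>d\<close>.
    The larger of the two drops by one once the other is omitted: for \<open>i < j\<close> this is
    \<open>c + t\<close>, otherwise \<open>d\<close>.\<close>
  have mixed: "face X N (if i < j then c + t - 1 else c + t) y = face X N (if i < j then d else d - 1) (x t)"
    if t: "t \<in> I" for t
  proof -
    have "face (vertical W k) (Suc m) t y = horizontal_map W k (Suc k) (coface (Suc k) v) m (x t)"
      using xy t by simp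
    then show ?thesis
      using voff_Suc[of k "Suc m"] hoff_Suc[of "Suc k" m]
      by (auto simp: vertical_face[OF It[OF t]] horizontal_map_face[OF v] N c_def d_def simp flip: N_def split: if_splits)
  qed
  define J where "J = insert d ((+) c ` I)"
  define x' where "x' u = (if u = d then y else x (u - c))" for u
  have x'I: "x' (c + t) = x t" if "t \<in> I" for t
    using dc It[OF that] by (auto simp: x'_def split: if_splits)
  have "J \<subseteq> {..Suc N}"
    using voff_le[of _ "Suc m" "Suc k"] hoff_le[OF v, of "Suc m"] It by (auto simp: J_def c_def d_def N)
  moreover have "J \<noteq> {..Suc N}"
  proof -
    define v' where "v' = (if v = 0 then 1 else 0 :: nat)"
    have v': "v' \<le> Suc k" "v' \<noteq> v" by (auto simp: v'_def)
    have "hoff (Suc k) (Suc m) + v' \<notin> J"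
      using off_less[of "Suc k" "Suc m"] ij v' It by (cases "i < j") (auto simp: J_def c_def d_def dest!: It)
    then show ?thesis using hoff_le[OF v'(1), of "Suc m"] by (auto simp: N)
  qed
  moreover have "matching X (Suc N) J x'"
    unfolding matching_def
  proof (intro conjI ballI impI)
    fix u assume "u \<in> J"
    then show "x' u \<in> scells X (Suc N - 1)"
      using xc x'I y by (auto simp: J_def x'_def vertical_cells N_def)
  next
    fix u w assume uw: "u \<in> J" "w \<in> J" "u < w"
    then consider (both) s t where "s \<in> I" "t \<in> I" "s < t" "u = c + s" "w = c + t"
      | (left) t where "t \<in> I" "u = d" "w = c + t"
      | (right) s where "s \<in> I" "u = c + s" "w = d"
      by (auto simp: J_def)
    then have "face X N u (x' w) = face X N (w - 1) (x' u)"
    proof cases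
      case both
      then show ?thesis using vertical_matching[OF x I m, of s t] by (simp add: x'I c N)
    next
      case left
      then have "i < j" using dc uw It[OF left(1)] by (auto split: if_splits)
      then show ?thesis using mixed[OF left(1)] left x'I by (simp add: x'_def[of d])
    next
      case right
      then have "\<not> i < j" using dc uw It[OF right(1)] by (auto split: if_splits)
      then show ?thesis using mixed[OF right(1)] right x'I by (simp add: x'_def[of d])
    qed
    then show "face X (Suc N - 1) u (x' w) = face X (Suc N - 1) (w - 1) (x' u)" by simp
  qed
  ultimately obtain z where z: "z \<in> scells X (Suc N)" "\<forall>u\<in>J. face X (Suc N) u z = x' u"
    using fill[of "Suc N" J x'] by (auto simp: J_def)
  have "face (vertical W (Suc k)) (Suc m) t z = x t" if t: "t \<in> I" for t
    using z(2) t x'I[OF t] by (simp add: vertical_face[OF It[OF t]] N J_def flip: c_def)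
  moreover have "horizontal_map W k (Suc k) (coface (Suc k) v) (Suc m) z = y"
    using z(2) by (simp add: horizontal_map_face[OF v] N J_def x'_def flip: d_def)
  ultimately show "\<exists>z\<in>scells (vertical W (Suc k)) (Suc m).
      (\<forall>t\<in>I. face (vertical W (Suc k)) (Suc m) t z = x t) \<and>
      horizontal_map W k (Suc k) (coface (Suc k) v) (Suc m) z = y"
    using z(1) by (intro bexI[of _ z]) (auto simp: vertical_cells N)
qed

section \<open>The columns and the horizontal face after taking 2-coskeleta\<close>

lemma kan_complex_vertical_csk: "kan_complex (vertical (vertical_csk 2 W) k)"
proof (rule kan_complex_agree[OF _ sset_agree_vertical_csk[OF bisimplicial_set_W]])
  have "kan_fibration (csk 2 (vertical W k)) (csk 2 point) (csk_map 2 (\<lambda>_ _. ()))"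
  proof (rule kan_fibration_csk[OF simplicial_map_point[OF simplicial_set_vertical[OF bisimplicial_set_W]]])
    fix m r :: nat assume m: "1 \<le> m" "r \<le> m"
    then show "lifts (vertical W k) point (\<lambda>_ _. ()) m ({..m} - {r})"
      using lifts_vertical[of "{..m} - {r}" "m - 1" k] horn_proper[OF m] by simp
  next
    \<comment> \<open>The parameter 1 of \<open>lifts_vertical\<close> means dimension 2; it is the
      least value for which that lemma admits the full boundary.\<close>
    show "lifts (vertical W k) point (\<lambda>_ _. ()) 2 {..2}"
      using lifts_vertical[of "{..2}" 1 k] by (simp add: numeral_2_eq_2)
  qed simp
  then show "kan_complex (csk 2 (vertical W k))"
    by (rule kan_complex_if_fibration) (rule csk_point)
qed

lemma kan_fibration_horizontal_face:
  "kan_fibration (vertical (vertical_csk 2 W) 1) (vertical (vertical_csk 2 W) 0)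
    (horizontal_face (vertical_csk 2 W) 1 0)"
proof (rule kan_fibration_agree[OF _ sset_agree_vertical_csk[OF bisimplicial_set_W]
      sset_agree_vertical_csk[OF bisimplicial_set_W]])
  let ?p = "horizontal_map W 0 (Suc 0) (coface (Suc 0) 0)"
  show "kan_fibration (csk 2 (vertical W 1)) (csk 2 (vertical W 0)) (csk_map 2 ?p)"
    unfolding One_nat_def
  proof (rule kan_fibration_csk[OF simplicial_map_horizontal[OF bisimplicial_set_W coface_in_Delta]])
    fix m r :: nat assume m: "1 \<le> m" "r \<le> m"
    then show "lifts (vertical W (Suc 0)) (vertical W 0) ?p m ({..m} - {r})"
      using lifts_horizontal[of "{..m} - {r}" "m - 1" 0 0] horn_proper[OF m] by simp
  next
    show "lifts (vertical W (Suc 0)) (vertical W 0) ?p 2 {..2}"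
      using lifts_horizontal[of "{..2}" 1 0 0] by (simp add: numeral_2_eq_2)
  qed simp_all
  show "horizontal_face (vertical_csk 2 W) 1 0 m \<phi> = csk_map 2 ?p m \<phi>"
    if "\<phi> \<in> scells (csk 2 (vertical W 1)) m" for m \<phi>
    using horizontal_map_vertical_csk[OF that] by (simp add: horizontal_face_def)
qed

end

theorem proposition2p39:
  fixes X :: "'a sset" and n :: nat
  assumes "n \<ge> 2" and "kan_complex X"
  shows "n2_fibrant n (Or n X)"
  unfolding n2_fibrant_def Let_def
proof (intro conjI ballI impI)
  show "nfold_simplicial_set n (Or n X)"
    using assms by (intro nfold_simplicial_set_Or) (auto simp: kan_complex_def)
  fix i j :: nat and a :: "nat \<Rightarrow> nat"
  assume *: "i \<in> {1..n}" "j \<in> {1..n}" "i \<noteq> j" "a \<in> ({1..n} - {i, j}) \<rightarrow>\<^sub>E UNIV"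
  interpret or_slice X n i j a by unfold_locales (use assms * in auto)
  show "kan_complex (vertical (vertical_csk 2 (bislice n (Or n X) i j a)) k)" for k
    using kan_complex_vertical_csk by (simp add: W_def)
  show "kan_fibration (vertical (vertical_csk 2 (bislice n (Or n X) i j a)) 1)
      (vertical (vertical_csk 2 (bislice n (Or n X) i j a)) 0)
      (horizontal_face (vertical_csk 2 (bislice n (Or n X) i j a)) 1 0)"
    using kan_fibration_horizontal_face by (simp add: W_def)
qed

end
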